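(* Let $f:\mathbb{D}\to\widehat{\mathbb{C}}$ be a centrally normalized spherically convex function. Then $$\Phi_s(r):=\frac{\displaystyle\int_{f(r\mathbb{T})}\kappa_s(w,f(r\mathbb{T}))\,\lambda_{\widehat{\mathbb{C}}}(w)\,|dw|}{\displaystyle\int_{r\mathbb{T}}\kappa_s(z,r\mathbb{T})\,\lambda_{\widehat{\mathbb{C}}}(z)\,|dz|}$$ is a strictly increasing function of $r\in(0,1)$, unless $f$ is a spherical isometry, in which case $\Phi_s(r)\equiv 1$.
   Context: $\mathbb{D}=\{z\in\mathbb{C}:|z|<1\}$, $\mathbb{T}=\partial\mathbb{D}$, $r\mathbb{T}=\{|z|=r\}$; $\widehat{\mathbb{C}}=\mathbb{C}\cup\{\infty\}$ is the Riemann sphere with the spherical metric $\lambda_{\widehat{\mathbb{C}}}(z)|dz|=\frac{|dz|}{1+|z|^2}$ (Gaussian curvature $+4$). For two non-antipodal points $a,b\in\widehat{\mathbb{C}}$, the spherical geodesic joining them is the smaller arc of the great circle through $a$ and $b$. A domain $\Omega\subset\widehat{\mathbb{C}}$ is spherically convex if for any two points $a,b\in\Omega$ that are not antipodal the spherical geodesic joining $a$ and $b$ lies in $\Omega$. A meromorphic univalent (injective) map $f:\mathbb{D}\to\widehat{\mathbb{C}}$ is called spherically convex if $f(\mathbb{D})$ is a spherically convex domain. The spherical derivative is $f^{\sharp}(z)=\frac{|f'(z)|}{1+|f(z)|^2}$. A spherically convex function $f$ is centrally normalized if $$f(z)=\alpha z+a_3z^3+\cdots,\quad z\in\mathbb{D},\qquad\text{where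 }\alpha=\max_{z\in\mathbb{D}}(1-|z|^2)f^{\sharp}(z)$$ (in particular $f(0)=0$ and $f''(0)=0$). The group of (meromorphic) spherical isometries is $$\mathrm{Rot}(\widehat{\mathbb{C}})=\left\{e^{i\theta}\frac{z-a}{1+z\overline{a}}: a\in\mathbb{C},\theta\in\mathbb{R}\right\}\cup\left\{\frac{e^{i\theta}}{z}:\theta\in\mathbb{R}\right\};$$ "$f$ is a spherical isometry" means that $f$ is the restriction to $\mathbb{D}$ of an element of $\mathrm{Rot}(\widehat{\mathbb{C}})$. For a $C^2$ curve $\gamma:z=z(t)$ with non-vanishing tangent, the spherical curvature $\kappa_s(z(t),\gamma)$ is defined by $$\kappa_s(z(t),\gamma)\,\lambda_{\widehat{\mathbb{C}}}(z(t))=\kappa(z(t),\gamma)-\operatorname{Im}\left\{\frac{2\overline{z(t)}z'(t)}{(1+|z(t)|^2)|z'(t)|}\right\},$$ where $\kappa(z(t),\gamma)$ is the (signed) euclidean curvature. The total spherical curvature of $\gamma$ is $\int_\gamma\kappa_s(w,\gamma)\lambda_{\widehat{\mathbb{C}}}(w)|dw|$. The curves $r\mathbb{T}$ and $f(r\mathbb{T})$ are parametrized by $t\mapsto re^{it}$ and $t\mapsto f(re^{it})$, $t\in[0,2\pi]$. In particular $\int_{r\mathbb{T}}\kappa_s(z,r\mathbb{T})\lambda_{\widehat{\mathbb{C}}}(z)|dz|=2\pi\frac{1-r^2}{1+r^2}$. *)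

theory Defs
  imports "HOL-Complex_Analysis.Complex_Analysis"
begin

section \<open>The Riemann sphere\<close>

text \<open>The extended plane is \<^typ>\<open>complex option\<close>, with \<^term>\<open>None\<close> as the point at infinity and the
  one-point compactification as its topology.\<close>

type_synonym riemann_sphere = "complex option"

abbreviation sphere_topology :: "riemann_sphere topology" where
  "sphere_topology \<equiv> Alexandroff_compactification euclidean"

text \<open>The isometry (up to the scaling factor 2) of the sphere with the metric
  \<open>|dz| / (1 + |z|\<^sup>2)\<close> onto the unit sphere of \<open>\<complex> \<times> \<real>\<close>.\<close>

definition stereographic :: "riemann_sphere \<Rightarrow> complex \<times> real" where
  "stereographic p = (case p of
      None \<Rightarrow> (0, 1)
    | Some z \<Rightarrow> (2 * z / of_real (1 + (cmod z)\<^sup>2), ((cmod z)\<^sup>2 - 1) / ((cmod z)\<^sup>2 + 1)))"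

definition antipodal :: "riemann_sphere \<Rightarrow> riemann_sphere \<Rightarrow> bool" where
  "antipodal p q \<longleftrightarrow> stereographic q = - stereographic p"

text \<open>On the unit sphere the great circle through \<open>A\<close> and \<open>B\<close> lies in the plane spanned by \<open>A\<close> and
  \<open>B\<close>; its smaller arc between non-antipodal \<open>A\<close> and \<open>B\<close> is the part lying in the
  cone of the \<open>s *\<^sub>R A + t *\<^sub>R B\<close> with \<open>s, t \<ge> 0\<close> (just \<open>{A}\<close> if \<open>A = B\<close>).\<close>

definition spherical_geodesic :: "riemann_sphere \<Rightarrow> riemann_sphere \<Rightarrow> riemann_sphere set" where
  "spherical_geodesic p q = {x. \<exists>s t :: real. 0 \<le> s \<and> 0 \<le> t \<and>
      stereographic x = s *\<^sub>R stereographic p + t *\<^sub>R stereographic q}"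

definition sphere_domain :: "riemann_sphere set \<Rightarrow> bool" where
  "sphere_domain \<Omega> \<longleftrightarrow> \<Omega> \<noteq> {} \<and> openin sphere_topology \<Omega> \<and> connectedin sphere_topology \<Omega>"

definition spherically_convex_domain :: "riemann_sphere set \<Rightarrow> bool" where
  "spherically_convex_domain \<Omega> \<longleftrightarrow> sphere_domain \<Omega> \<and>
     (\<forall>p\<in>\<Omega>. \<forall>q\<in>\<Omega>. \<not> antipodal p q \<longrightarrow> spherical_geodesic p q \<subseteq> \<Omega>)"

lemma norm_stereographic: "norm (stereographic p) = 1"
proof (cases p)
  case (Some z)
  define d where "d = 1 + (cmod z)\<^sup>2"
  have d: "d > 0" by (simp add: d_def add_pos_nonneg)
  have "(norm (stereographic p))\<^sup>2 = (2 * cmod z / d)\<^sup>2 + (((cmod z)\<^sup>2 - 1) / d)\<^sup>2"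
    using d unfolding Some stereographic_def option.case norm_Pair d_def[symmetric]
      add.commute[of "(cmod z)\<^sup>2" 1] norm_divide norm_mult norm_of_real
    by (simp add: power_divide)
  also have "\<dots> = d\<^sup>2 / d\<^sup>2"
    unfolding power_divide add_divide_distrib[symmetric]
    by (simp add: d_def power2_eq_square algebra_simps)
  finally have "(norm (stereographic p))\<^sup>2 = 1" using d by simp
  then have "norm (stereographic p) = 1 \<or> norm (stereographic p) = - 1"
    by (simp only: power2_eq_1_iff)
  then show ?thesis using norm_ge_zero[of "stereographic p"] by linarith
qed (simp add: stereographic_def)

lemma antipodal_Some: "z \<noteq> 0 \<Longrightarrow> antipodal (Some z) (Some (- 1 / cnj z))"
proof -
  assume z: "z \<noteq> 0"
  define n where "n = (cmod z)\<^sup>2"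
  have n: "n > 0" using z by (simp add: n_def)
  have e: "(cmod (- 1 / cnj z))\<^sup>2 = 1 / n"
    by (simp add: n_def norm_divide power_divide)
  have c: "cnj z = of_real n / z"
    using z by (simp add: n_def complex_norm_square del: of_real_power)
  have "(1 / n - 1) / (1 / n + 1) = - ((n - 1) / (n + 1))"
  proof -
    have "1 / n - 1 = (1 - n) / n" "1 / n + 1 = (n + 1) / n" using n by (simp_all add: field_simps)
    then show ?thesis using n by (simp add: minus_divide_left)
  qed
  moreover have "2 * (- 1 / cnj z) / of_real (1 + 1 / n) = - (2 * z / of_real (1 + n))"
  proof -
    have "1 + 1 / n = (1 + n) / n" using n by (simp add: field_simps)
    then show ?thesis unfolding c using n z by (simp add: field_simps)
  qed
  ultimately show ?thesis
    unfolding antipodal_def stereographic_def option.case e n_def[symmetric] by simp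
qed

lemma antipodal_0: "antipodal (Some 0) None"
  by (simp add: antipodal_def stereographic_def)


section \<open>Meromorphic maps into the sphere\<close>

abbreviation unit_disc :: "complex set" where
  "unit_disc \<equiv> ball 0 1"

text \<open>A function that is nicely meromorphic has the junk value 0 at its poles; \<open>sphere_map f\<close> is
  the actual map into the sphere.\<close>

definition sphere_map :: "(complex \<Rightarrow> complex) \<Rightarrow> complex \<Rightarrow> riemann_sphere" where
  "sphere_map f z = (if is_pole f z then None else Some (f z))"

definition spherically_convex :: "(complex \<Rightarrow> complex) \<Rightarrow> bool" where
  "spherically_convex f \<longleftrightarrow> f nicely_meromorphic_on unit_disc \<and> inj_on (sphere_map f) unit_disc \<and>
     spherically_convex_domain (sphere_map f ` unit_disc)"

text \<open>At a pole the spherical derivative is that of \<open>1 / f\<close>, the continuous extension of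
  \<open>|f'| / (1 + |f|\<^sup>2)\<close>. (There \<open>f z = 0\<close> makes \<open>inverse (f z) = 0\<close>, the right value.)\<close>

definition spherical_deriv :: "(complex \<Rightarrow> complex) \<Rightarrow> complex \<Rightarrow> real" where
  "spherical_deriv f z =
     (if is_pole f z then cmod (deriv (\<lambda>w. inverse (f w)) z)
      else cmod (deriv f z) / (1 + (cmod (f z))\<^sup>2))"

text \<open>The Taylor expansion is required near 0 only, so that \<open>f\<close> is not assumed to be free of
  poles in the disc.\<close>

definition centrally_normalized :: "(complex \<Rightarrow> complex) \<Rightarrow> bool" where
  "centrally_normalized f \<longleftrightarrow> (\<exists>(\<alpha>::real) F.
     f has_fps_expansion F \<and>
     fps_nth F 0 = 0 \<and> fps_nth F 1 = of_real \<alpha> \<and> fps_nth F 2 = 0 \<and>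
     (\<exists>z\<in>unit_disc. \<alpha> = (1 - (cmod z)\<^sup>2) * spherical_deriv f z) \<and>
     (\<forall>z\<in>unit_disc. (1 - (cmod z)\<^sup>2) * spherical_deriv f z \<le> \<alpha>))"


section \<open>Spherical isometries\<close>

definition moebius_sphere ::
    "complex \<Rightarrow> complex \<Rightarrow> complex \<Rightarrow> complex \<Rightarrow> riemann_sphere \<Rightarrow> riemann_sphere" where
  "moebius_sphere a b c d p = (case p of
      None \<Rightarrow> if c = 0 then None else Some (a / c)
    | Some z \<Rightarrow> if c * z + d = 0 then None else Some ((a * z + b) / (c * z + d)))"

definition Rot :: "(riemann_sphere \<Rightarrow> riemann_sphere) set" where
  "Rot = {moebius_sphere (cis \<theta>) (- cis \<theta> * a) (cnj a) 1 | (a::complex) (\<theta>::real). True}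
       \<union> {moebius_sphere 0 (cis \<theta>) 1 0 | (\<theta>::real). True}"

definition spherical_isometry :: "(complex \<Rightarrow> complex) \<Rightarrow> bool" where
  "spherical_isometry f \<longleftrightarrow> (\<exists>T\<in>Rot. \<forall>z\<in>unit_disc. sphere_map f z = T (Some z))"


section \<open>Spherical curvature\<close>

definition spherical_density :: "complex \<Rightarrow> real" where
  "spherical_density z = 1 / (1 + (cmod z)\<^sup>2)"

definition euclidean_curvature :: "(real \<Rightarrow> complex) \<Rightarrow> real \<Rightarrow> real" where
  "euclidean_curvature \<gamma> t =
     (let v = vector_derivative \<gamma> (at t);
          a = vector_derivative (\<lambda>s. vector_derivative \<gamma> (at s)) (at t)
      in Im (cnj v * a) / (cmod v) ^ 3)"

definition spherical_curvature :: "(real \<Rightarrow> complex) \<Rightarrow> real \<Rightarrow> real" where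
  "spherical_curvature \<gamma> t =
     (let z = \<gamma> t; v = vector_derivative \<gamma> (at t)
      in (euclidean_curvature \<gamma> t
            - Im (2 * cnj z * v / of_real ((1 + (cmod z)\<^sup>2) * cmod v)))
          / spherical_density z)"

definition total_spherical_curvature :: "real \<Rightarrow> real \<Rightarrow> (real \<Rightarrow> complex) \<Rightarrow> real" where
  "total_spherical_curvature a b \<gamma> =
     integral {a..b} (\<lambda>t. spherical_curvature \<gamma> t * spherical_density (\<gamma> t)
                            * cmod (vector_derivative \<gamma> (at t)))"

text \<open>The curvature formula is for curves in the finite plane. This is no restriction here:
  a spherically convex image of the disc that contains 0 omits the antipode \<open>\<infinity>\<close> of 0
  (a convex domain containing an antipodal pair is the whole sphere, which is not homeomorphic
  to the disc), so \<open>f\<close> has no poles.\<close>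

definition Phi_s :: "(complex \<Rightarrow> complex) \<Rightarrow> real \<Rightarrow> real" where
  "Phi_s f r =
     total_spherical_curvature 0 (2 * pi) (\<lambda>t. f (of_real r * cis t))
     / total_spherical_curvature 0 (2 * pi) (\<lambda>t. of_real r * cis t)"

lemma total_spherical_curvature_circle:
  fixes r :: real
  assumes r: "r > 0"
  shows "total_spherical_curvature 0 (2 * pi) (\<lambda>t. of_real r * cis t)
           = 2 * pi * (1 - r\<^sup>2) / (1 + r\<^sup>2)"
proof -
  have d: "vector_derivative (\<lambda>t. c * cis t) (at t) = c * \<i> * cis t" for c t
  proof (rule vector_derivative_at)
    have "((\<lambda>u. c * exp (\<i> * u)) has_field_derivative c * \<i> * exp (\<i> * of_real t)) (at (of_real t))"
      by (auto intro!: derivative_eq_intros)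
    from has_vector_derivative_real_field[OF this]
    show "((\<lambda>t. c * cis t) has_vector_derivative c * \<i> * cis t) (at t)"
      by (simp add: cis_conv_exp)
  qed
  have p: "1 + r\<^sup>2 > 0" by (simp add: add_pos_nonneg)
  have cc: "cnj (cis t) * cis t = 1" for t
    by (metis cis_cnj cis_mult cis_zero add.left_inverse)
  have k: "euclidean_curvature (\<lambda>t. of_real r * cis t) t = 1 / r" for t
  proof -
    have "cnj (of_real r * \<i> * cis t) * (of_real r * \<i> * \<i> * cis t)
        = - (\<i> * \<i>) * \<i> * of_real (r\<^sup>2) * (cnj (cis t) * cis t)"
      by (simp only: complex_cnj_mult complex_cnj_i complex_cnj_complex_of_real
           power2_eq_square of_real_mult) (simp only: algebra_simps minus_mult_left[symmetric] minus_mult_right[symmetric])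
    then have "cnj (of_real r * \<i> * cis t) * (of_real r * \<i> * \<i> * cis t)
        = \<i> * of_real (r\<^sup>2) * (cnj (cis t) * cis t)" by simp
    then show ?thesis
      using r unfolding euclidean_curvature_def Let_def d cc
      by (simp add: norm_mult power2_eq_square power3_eq_cube)
  qed
  have i: "cnj (of_real r * cis t) * (of_real r * \<i> * cis t) = \<i> * of_real (r\<^sup>2)" for t
  proof -
    have "cnj (of_real r * cis t) * (of_real r * \<i> * cis t) = \<i> * of_real (r\<^sup>2) * (cnj (cis t) * cis t)"
      by (simp add: power2_eq_square)
    then show ?thesis by (simp add: cc)
  qed
  have s: "spherical_curvature (\<lambda>t. of_real r * cis t) t * spherical_density (of_real r * cis t)
             * cmod (vector_derivative (\<lambda>t. of_real r * cis t) (at t)) = (1 - r\<^sup>2) / (1 + r\<^sup>2)" for t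
  proof -
    have "Im (2 * cnj (of_real r * cis t) * (of_real r * \<i> * cis t) / of_real ((1 + r\<^sup>2) * r))
        = 2 * r / (1 + r\<^sup>2)"
      unfolding mult.assoc[of 2] i using r p
      by (simp add: Im_divide_of_real power2_eq_square)
    moreover have "cmod (of_real r * cis t) = r" "cmod (of_real r * \<i> * cis t) = r"
      using r by (simp_all add: norm_mult)
    ultimately have "spherical_curvature (\<lambda>t. of_real r * cis t) t * spherical_density (of_real r * cis t)
        * cmod (vector_derivative (\<lambda>t. of_real r * cis t) (at t))
      = (1 / r - 2 * r / (1 + r\<^sup>2)) / (1 / (1 + r\<^sup>2)) * (1 / (1 + r\<^sup>2)) * r"
      unfolding spherical_curvature_def Let_def k d spherical_density_def by (simp only:)
    also have "\<dots> = (1 / r - 2 * r / (1 + r\<^sup>2)) * r"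
      using p by simp
    also have "\<dots> = (1 - r\<^sup>2) / (1 + r\<^sup>2)"
    proof -
      have "(1 / r - 2 * r / (1 + r\<^sup>2)) * r = 1 - 2 * r\<^sup>2 / (1 + r\<^sup>2)"
        using r by (simp add: left_diff_distrib power2_eq_square)
      also have "\<dots> = (1 + r\<^sup>2) / (1 + r\<^sup>2) - 2 * r\<^sup>2 / (1 + r\<^sup>2)"
        using p by simp
      also have "\<dots> = (1 - r\<^sup>2) / (1 + r\<^sup>2)"
        unfolding diff_divide_distrib[symmetric] by simp
      finally show ?thesis .
    qed
    finally show ?thesis .
  qed
  show ?thesis
    unfolding total_spherical_curvature_def s by simp
qed

end

theory Submission
  imports Defs
begin

text \<open>The total curvature of \<open>f(r\<T>)\<close> is an angular mean, and the point is that this mean is the value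
  at \<open>r\<^sup>2\<close> of a positive harmonic function on the disc; the theorem is then Harnack's inequality.

  Rotate the sphere so that a point \<open>f \<zeta>\<close> of \<open>f(\<D>)\<close> moves to \<open>0\<close>. In this chart the image of \<open>f\<close>
  is convex in the Euclidean sense (\<open>convex_chart\<close>). For a convex map \<open>g\<close> and \<open>\<bar>z\<bar> = \<bar>\<zeta>\<bar>\<close> the
  real part of \<open>z g'(z) / (g z - g \<zeta>)\<close> is nonnegative (\<open>convex_map_two_points\<close>). Written
  in terms of \<open>f\<close> this says that, for \<open>z \<noteq> \<zeta>\<close> on a common circle about \<open>0\<close>,
  \<open>Re (z f'(z) cnj (f \<zeta>) / (1 + cnj (f \<zeta>) f(z))) \<le> Re (z f'(z) / (f z - f \<zeta>))\<close>
  (\<open>two_point_inequality\<close>).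
  Put \<open>q = z cnj \<zeta>\<close> and take the mean over all such pairs with fixed \<open>q\<close>. The right hand side is
  holomorphic in \<open>z\<close> when \<open>\<zeta> = e z\<close>, so its mean is \<open>Re (1 / (1 - e)) = 1/2\<close> whatever \<open>f\<close> is.
  On the left \<open>cnj \<zeta> = q / z\<close>, so twice the mean is a contour integral
  \<open>mean_kernel q\<close> that depends holomorphically on \<open>q\<close>. Hence \<open>P = 1 - mean_kernel\<close> is
  holomorphic on the disc, \<open>P 0 = 1\<close> and \<open>Re P \<ge> 0\<close> (\<open>Re_mean_kernel_le_1\<close>).

  For \<open>q = r\<^sup>2\<close> the pairs are \<open>\<zeta> = z\<close>, and the kernel becomes exactly the correction term in the
  spherical curvature of \<open>f(r\<T>)\<close>, whose total is therefore \<open>2 \<pi> Re P(r\<^sup>2)\<close>. With \<open>x = r\<^sup>2\<close> this gives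
  \<open>Phi_s f r = Re P(x) (1 + x) / (1 - x)\<close>. The Schwarz-Pick bound
  \<open>\<bar>P'(x)\<bar> \<le> 2 Re P(x) / (1 - x\<^sup>2)\<close> says that the derivative of this product is nonnegative.

  If the product takes the same value twice, then the bound is attained on an interval, which forces
  \<open>P q = (1 - q) / (1 + q)\<close> and \<open>P'(0) = - 2\<close>; but \<open>P'(0) = - 2 \<bar>f'(0)\<bar>\<^sup>2\<close>, so \<open>\<bar>f'(0)\<bar> = 1\<close>. Now \<open>f(\<D>)\<close>
  lies in a hemisphere, because its cone in \<open>\<real>\<^sup>3\<close> is convex and omits \<open>0\<close>. Rotating this hemisphere
  onto the unit disc turns \<open>f\<close> into a function bounded by \<open>1\<close>, and Cauchy's estimate at \<open>0\<close> leaves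
  room only for the trivial rotation; Schwarz's lemma yields \<open>f z = b z\<close>.\<close>


section \<open>Geodesically closed sets on the sphere\<close>

definition geodesically_closed :: "riemann_sphere set \<Rightarrow> bool" where
  "geodesically_closed \<Omega> \<longleftrightarrow>
     (\<forall>p\<in>\<Omega>. \<forall>q\<in>\<Omega>. \<not> antipodal p q \<longrightarrow> spherical_geodesic p q \<subseteq> \<Omega>)"

lemma geodesically_closedD:
  "geodesically_closed \<Omega> \<Longrightarrow> p \<in> \<Omega> \<Longrightarrow> q \<in> \<Omega> \<Longrightarrow> \<not> antipodal p q \<Longrightarrow> spherical_geodesic p q \<subseteq> \<Omega>"
  by (auto simp: geodesically_closed_def)

text \<open>This is the rotation of the unit sphere that corresponds under stereographic projection to the
  Moebius map \<open>p \<mapsto> (p + w) / (1 - cnj w p)\<close>, which carries \<open>0\<close> to \<open>w\<close>.\<close>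
definition sphere_rotation :: "complex \<Rightarrow> complex \<times> real \<Rightarrow> complex \<times> real" where
  "sphere_rotation w x =
     ((fst x - w\<^sup>2 * cnj (fst x) - 2 * w * of_real (snd x)) / of_real (1 + (cmod w)\<^sup>2),
      ((1 - (cmod w)\<^sup>2) * snd x + 2 * Re (fst x * cnj w)) / (1 + (cmod w)\<^sup>2))"

lemma one_plus_cmod_sq_pos: "0 < 1 + (cmod z)\<^sup>2"
  by (simp add: add_pos_nonneg)

lemma sphere_rotation_linear: "linear (sphere_rotation w)"
  by (intro linearI)
     (auto simp: sphere_rotation_def prod_eq_iff algebra_simps add_divide_distrib diff_divide_distrib scaleR_conv_of_real)

lemma sphere_rotation_inverse: "sphere_rotation (- w) (sphere_rotation w x) = x"
proof -
  define n where "n = (cmod w)\<^sup>2"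
  have d: "1 + n > 0" by (simp add: n_def one_plus_cmod_sq_pos)
  then have d': "of_real (1 + n) \<noteq> (0::complex)" by (metis less_irrefl of_real_eq_0_iff)
  obtain \<xi> h where x: "x = (\<xi>, h)" by (cases x)
  have n: "of_real n = w * cnj w" by (simp add: n_def complex_norm_square del: of_real_power)
  define \<xi>' where "\<xi>' = \<xi> - w\<^sup>2 * cnj \<xi> - 2 * w * of_real h"
  define h' where "h' = (1 - n) * h + 2 * Re (\<xi> * cnj w)"
  have h': "of_real h' = (1 - w * cnj w) * of_real h + (\<xi> * cnj w + cnj \<xi> * w)"
    unfolding h'_def of_real_add of_real_mult of_real_diff n complex_add_cnj[symmetric]
    by (simp add: complex_eq_iff)
  have 1: "\<xi>' - w\<^sup>2 * cnj \<xi>' + 2 * w * of_real h' = of_real ((1 + n)\<^sup>2) * \<xi>"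
    unfolding h' of_real_power of_real_add n \<xi>'_def by (simp add: algebra_simps power2_eq_square)
  have "Re (\<xi>' * cnj w) = (1 - n) * Re (\<xi> * cnj w) - 2 * n * h"
  proof -
    have "\<xi>' * cnj w = \<xi> * cnj w - of_real n * (w * cnj \<xi>) - of_real (2 * n * h)"
      unfolding \<xi>'_def of_real_mult n by (simp add: algebra_simps power2_eq_square)
    moreover have "Re (w * cnj \<xi>) = Re (\<xi> * cnj w)" by simp
    ultimately show ?thesis by (simp only: minus_complex.sel Re_complex_of_real times_complex.sel Im_complex_of_real) (simp add: algebra_simps)
  qed
  then have 2: "(1 - n) * h' - 2 * Re (\<xi>' * cnj w) = (1 + n)\<^sup>2 * h"
    unfolding h'_def by (simp only:) (simp add: algebra_simps power2_eq_square)
  have rot: "sphere_rotation w x = (\<xi>' / of_real (1 + n), h' / (1 + n))"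
    by (simp add: sphere_rotation_def x \<xi>'_def h'_def n_def)
  have "(\<xi>' / of_real (1 + n) - w\<^sup>2 * cnj (\<xi>' / of_real (1 + n)) + 2 * w * of_real (h' / (1 + n))) / of_real (1 + n)
      = (\<xi>' - w\<^sup>2 * cnj \<xi>' + 2 * w * of_real h') / of_real ((1 + n)\<^sup>2)"
    by (simp add: power2_eq_square add_divide_distrib diff_divide_distrib del: of_real_add)
  also have "\<dots> = \<xi>" unfolding 1 using d' by (simp del: of_real_add)
  finally have c1: "(\<xi>' / of_real (1 + n) - w\<^sup>2 * cnj (\<xi>' / of_real (1 + n)) + 2 * w * of_real (h' / (1 + n))) / of_real (1 + n) = \<xi>" .
  have "\<xi>' / of_real (1 + n) * cnj w = of_real (1 / (1 + n)) * (\<xi>' * cnj w)" by simp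
  then have "Re (\<xi>' / of_real (1 + n) * cnj w) = Re (\<xi>' * cnj w) / (1 + n)"
    by (simp only: times_complex.sel Re_complex_of_real Im_complex_of_real) simp
  then have "((1 - n) * (h' / (1 + n)) - 2 * Re (\<xi>' / of_real (1 + n) * cnj w)) / (1 + n)
      = ((1 - n) * h' - 2 * Re (\<xi>' * cnj w)) / (1 + n)\<^sup>2"
    by (simp only:) (simp add: power2_eq_square diff_divide_distrib)
  also have "\<dots> = h" unfolding 2 using d by simp
  finally have c2: "((1 - n) * (h' / (1 + n)) - 2 * Re (\<xi>' / of_real (1 + n) * cnj w)) / (1 + n) = h" .
  show ?thesis
    using c1 c2 unfolding rot unfolding sphere_rotation_def norm_minus_cancel fst_conv snd_conv n_def[symmetric]
    by (simp add: x del: of_real_add of_real_divide)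
qed

text \<open>The chart at \<open>w\<close> respects geodesics because it acts linearly on \<open>\<real>\<^sup>3\<close>. The case distinction
  concerns the point of the chart that goes to infinity.\<close>
lemma stereographic_moebius:
  "stereographic (moebius_sphere 1 w (- cnj w) 1 (Some p)) = sphere_rotation w (stereographic (Some p))"
proof -
  obtain a b where w: "w = Complex a b" by (metis complex.collapse)
  obtain u v where p: "p = Complex u v" by (metis complex.collapse)
  show ?thesis
  proof (cases "- cnj w * p + 1 = 0")
    case True
    then have wp: "cnj w * p = 1" by simp
    then have w0: "w \<noteq> 0" by auto
    have p': "p = w / of_real ((cmod w)\<^sup>2)"
      using wp w0 by (simp add: complex_norm_square field_simps del: of_real_power)
    define n where "n = (cmod w)\<^sup>2"
    have n: "n > 0" using w0 by (simp add: n_def)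
    have cp: "(cmod p)\<^sup>2 = 1 / n"
      using w0 unfolding p' n_def norm_divide norm_of_real by (simp add: power2_eq_square)
    have ww: "w * cnj w = of_real n" by (simp add: n_def complex_norm_square del: of_real_power)
    have "stereographic (Some p) = (2 * w / of_real (1 + n), (1 - n) / (1 + n))"
    proof -
      have a: "1 + 1 / n = (1 + n) / n" "1 / n - 1 = (1 - n) / n" "1 / n + 1 = (1 + n) / n"
        using n by (simp_all add: field_simps)
      show ?thesis unfolding stereographic_def option.case cp a
        unfolding p' n_def[symmetric] of_real_divide using n by simp
    qed
    moreover have "2 * w / of_real (1+n) - w\<^sup>2 * cnj (2 * w / of_real (1+n)) - 2 * w * of_real ((1-n)/(1+n)) = 0"
    proof -
      have "w\<^sup>2 * cnj w = of_real n * w" by (simp add: ww[symmetric] power2_eq_square)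
      then have "2 * w - 2 * (w\<^sup>2 * cnj w) - 2 * w * of_real (1 - n) = 0" by (simp add: algebra_simps)
      moreover have "2 * w / of_real (1+n) - w\<^sup>2 * cnj (2 * w / of_real (1+n)) - 2 * w * of_real ((1-n)/(1+n))
          = (2 * w - 2 * (w\<^sup>2 * cnj w) - 2 * w * of_real (1 - n)) / of_real (1 + n)"
        by (simp add: diff_divide_distrib[of _ _ "of_real _"] del: of_real_add of_real_diff)
      ultimately show ?thesis by simp
    qed
    moreover have "((1 - n) * ((1-n)/(1+n)) + 2 * Re (2 * w / of_real (1+n) * cnj w)) / (1 + n) = 1"
    proof -
      have "2 * w / of_real (1+n) * cnj w = 2 * of_real n / of_real (1+n)" by (simp add: ww[symmetric])
      also have "\<dots> = of_real (2 * n / (1+n))" by simp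
      finally have "Re (2 * w / of_real (1+n) * cnj w) = 2 * n / (1+n)" by (metis Re_complex_of_real)
      moreover have "(1 - n) * ((1-n)/(1+n)) + 2 * (2 * n / (1+n)) = ((1 - n) * (1 - n) + 4 * n) / (1 + n)"
        by (simp add: add_divide_distrib)
      moreover have "(1 - n) * (1 - n) + 4 * n = (1 + n) * (1 + n)" by (simp add: algebra_simps)
      ultimately show ?thesis using n by simp
    qed
    ultimately show ?thesis using True
      by (simp add: sphere_rotation_def moebius_sphere_def stereographic_def n_def)
  next
    case False
    define d where "d = 1 - cnj w * p"
    have d0: "d \<noteq> 0" using False by (simp add: d_def)
    define p' where "p' = (p + w) / d"
    define N where "N = 1 + (cmod p)\<^sup>2"
    define M where "M = 1 + (cmod w)\<^sup>2"
    have pos: "N > 0" "M > 0" by (simp_all add: N_def M_def one_plus_cmod_sq_pos)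
    define D where "D = (cmod d)\<^sup>2"
    have D: "D > 0" using d0 by (simp add: D_def)
    have e1: "D + (cmod (p + w))\<^sup>2 = M * N" "(cmod (p + w))\<^sup>2 - D = (M - 2) * (2 - N) + 4 * Re (p * cnj w)"
      unfolding D_def d_def N_def M_def w p cmod_power2 by (simp_all add: power2_eq_square algebra_simps)
    have cp: "(cmod p')\<^sup>2 = (cmod (p + w))\<^sup>2 / D" by (simp add: p'_def D_def norm_divide power_divide)
    have e2: "1 + (cmod p')\<^sup>2 = M * N / D" "(cmod p')\<^sup>2 + 1 = M * N / D" "(cmod p')\<^sup>2 - 1 = ((M - 2) * (2 - N) + 4 * Re (p * cnj w)) / D"
      unfolding cp e1(1)[symmetric] e1(2)[symmetric] using D by (simp_all add: field_simps)
    have dc: "1 / d = cnj d / of_real D" unfolding D_def using d0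
      by (simp add: complex_norm_square field_simps del: of_real_power)
    have pp: "p * cnj p = of_real (N - 1)" by (simp add: N_def complex_norm_square del: of_real_power)
    have "2 * p' / of_real (1 + (cmod p')\<^sup>2) = 2 * (p + w) * cnj d / of_real (M * N)"
    proof -
      have "2 * p' = 2 * (p + w) * cnj d / of_real D" using dc unfolding p'_def by (metis divide_inverse inverse_eq_divide mult.assoc times_divide_eq_right)
      then show ?thesis unfolding e2 using D by simp
    qed
    moreover have "(p + w) * cnj d = p - w\<^sup>2 * cnj p - w * of_real (N - 2)"
    proof -
      have "(p + w) * cnj d = p + w - w * (p * cnj p) - w\<^sup>2 * cnj p"
        by (simp add: d_def algebra_simps power2_eq_square)
      then show ?thesis unfolding pp by (simp add: algebra_simps)
    qed
    then have "2 * (p + w) * cnj d = 2 * p - w\<^sup>2 * cnj (2 * p) - 2 * w * of_real (N - 2)"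
      unfolding mult.assoc[of 2 "p + w"] by (simp only:) (simp add: algebra_simps)
    ultimately have f1: "2 * p' / of_real (1 + (cmod p')\<^sup>2) = (2 * p - w\<^sup>2 * cnj (2 * p) - 2 * w * of_real (N - 2)) / of_real (M * N)" by (simp only:)
    have f2: "((cmod p')\<^sup>2 - 1) / ((cmod p')\<^sup>2 + 1) = ((M - 2) * (2 - N) + 4 * Re (p * cnj w)) / (M * N)"
      unfolding e2 using D by simp
    have s: "stereographic (Some p) = (2 * p / of_real N, (N - 2) / N)"
      by (simp add: stereographic_def N_def add.commute)
    have r: "2 * Re (2 * p / of_real N * cnj w) = 4 * Re (p * cnj w) / N"
    proof -
      have "2 * p / of_real N * cnj w = of_real (2 / N) * (p * cnj w)" by simp
      then show ?thesis by (simp only: times_complex.sel Re_complex_of_real Im_complex_of_real) simp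
    qed
    have g1: "(2 * p / of_real N - w\<^sup>2 * cnj (2 * p / of_real N) - 2 * w * of_real ((N - 2) / N)) / of_real M
       = (2 * p - w\<^sup>2 * cnj (2 * p) - 2 * w * of_real (N - 2)) / of_real (M * N)"
      using pos by (simp add: field_simps)
    have g2: "((2 - M) * ((N - 2) / N) + 4 * Re (p * cnj w) / N) / M = ((M - 2) * (2 - N) + 4 * Re (p * cnj w)) / (M * N)"
      using pos by (simp add: field_simps)
    have "moebius_sphere 1 w (- cnj w) 1 (Some p) = Some p'"
      using False by (simp add: moebius_sphere_def p'_def d_def)
    then show ?thesis
      unfolding s sphere_rotation_def fst_conv snd_conv M_def[symmetric] r
      using f1 f2 g1 g2 by (simp add: stereographic_def M_def)
  qed
qed

lemma stereographic_surj:
  assumes "norm x = 1"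
  obtains c where "stereographic c = x"
proof -
  obtain \<xi> h where x: "x = (\<xi>, h)" by (cases x)
  have n: "(cmod \<xi>)\<^sup>2 + h\<^sup>2 = 1" using assms by (simp add: x norm_Pair)
  show thesis
  proof (cases "h = 1")
    case True
    then show thesis using n that[of None] by (simp add: stereographic_def x)
  next
    case False
    have "h \<le> 1" using n by (metis abs_le_square_iff abs_one le_add_same_cancel2 abs_le_D1 one_power2 zero_le_power2)
    then have h: "1 - h > 0" using False by simp
    define z where "z = \<xi> / of_real (1 - h)"
    have "(cmod z)\<^sup>2 = (1 - h\<^sup>2) / (1 - h)\<^sup>2"
      using n unfolding z_def norm_divide norm_of_real power_divide by simp
    also have "1 - h\<^sup>2 = (1 + h) * (1 - h)" by (simp add: algebra_simps power2_eq_square)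
    also have "(1 + h) * (1 - h) / (1 - h)\<^sup>2 = (1 + h) / (1 - h)" using h
      by (simp add: power2_eq_square)
    finally have "(cmod z)\<^sup>2 = (1 + h) / (1 - h)" .
    then have "1 + (cmod z)\<^sup>2 = 2 / (1 - h)" "(cmod z)\<^sup>2 - 1 = 2 * h / (1 - h)"
      using h by (simp_all add: field_simps)
    moreover have "2 * z / of_real (2 / (1 - h)) = \<xi>"
      using h by (simp add: z_def)
    moreover have "2 * h / (1 - h) / (2 / (1-h)) = h" using h by simp
    ultimately have "stereographic (Some z) = x"
      unfolding stereographic_def x option.case add.commute[of "(cmod z)\<^sup>2" 1] by simp
    then show thesis using that by blast
  qed
qed

lemma not_antipodal_0: "\<not> antipodal (Some 0) (Some m)"
proof
  assume "antipodal (Some 0) (Some m)"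
  then have "((cmod m)\<^sup>2 - 1) / ((cmod m)\<^sup>2 + 1) = 1" by (simp add: antipodal_def stereographic_def)
  then show False using one_plus_cmod_sq_pos[of m] by (simp add: field_simps)
qed

text \<open>Great circles through \<open>0\<close> are lines, so a geodesically closed set that contains \<open>0\<close> is star-shaped
  about \<open>0\<close>. The geodesic from \<open>p\<close> to \<open>q\<close> bulges away from \<open>0\<close>, so every point of the
  segment from \<open>p\<close> to \<open>q\<close> lies between \<open>0\<close> and a point of the geodesic.\<close>
lemma convex_if_geodesically_closed:
  assumes S0: "0 \<in> S"
    and geo: "\<And>p q c. p \<in> S \<Longrightarrow> q \<in> S \<Longrightarrow> \<not> antipodal (Some p) (Some q) \<Longrightarrow>
                 Some c \<in> spherical_geodesic (Some p) (Some q) \<Longrightarrow> c \<in> S"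
  shows "convex S"
proof -
  have star: "of_real \<mu> * m \<in> S" if "m \<in> S" "0 \<le> \<mu>" "\<mu> \<le> 1" for m \<mu>
  proof -
    define n where "n = (cmod m)\<^sup>2"
    define t where "t = \<mu> * (1 + n) / (1 + \<mu>\<^sup>2 * n)"
    define s where "s = (1 - \<mu>) * (1 + \<mu> * n) / (1 + \<mu>\<^sup>2 * n)"
    have n: "n \<ge> 0" by (simp add: n_def)
    have d: "1 + \<mu>\<^sup>2 * n > 0" using n by (simp add: add_pos_nonneg)
    have st: "s \<ge> 0" "t \<ge> 0" using that n d by (auto simp: s_def t_def)
    have c: "(cmod (of_real \<mu> * m))\<^sup>2 = \<mu>\<^sup>2 * n" by (simp add: n_def norm_mult power_mult_distrib)
    have 1: "2 * (of_real \<mu> * m) / of_real (1 + \<mu>\<^sup>2 * n) = t *\<^sub>R (2 * m / of_real (1 + n))"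
    proof -
      have "of_real (1 + n) \<noteq> (0::complex)" using n by (metis add_pos_nonneg less_irrefl of_real_eq_0_iff zero_less_one)
      then show ?thesis by (simp add: t_def scaleR_conv_of_real)
    qed
    have 2: "(\<mu>\<^sup>2 * n - 1) / (\<mu>\<^sup>2 * n + 1) = s * (-1) + t * ((n - 1) / (n + 1))"
    proof -
      have "t * ((n - 1) / (n + 1)) = \<mu> * (n - 1) / (1 + \<mu>\<^sup>2 * n)"
        using n by (simp add: t_def add.commute)
      then have "s * (-1) + t * ((n - 1) / (n + 1)) = (- ((1 - \<mu>) * (1 + \<mu> * n)) + \<mu> * (n - 1)) / (1 + \<mu>\<^sup>2 * n)"
        unfolding s_def by (simp add: diff_divide_distrib)
      also have "- ((1 - \<mu>) * (1 + \<mu> * n)) + \<mu> * (n - 1) = \<mu>\<^sup>2 * n - 1"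
        by (simp add: algebra_simps power2_eq_square)
      finally show ?thesis by (simp add: add.commute)
    qed
    have "stereographic (Some (of_real \<mu> * m)) = s *\<^sub>R stereographic (Some 0) + t *\<^sub>R stereographic (Some m)"
      unfolding stereographic_def option.case c n_def[symmetric] 1 2 by simp
    then have "Some (of_real \<mu> * m) \<in> spherical_geodesic (Some 0) (Some m)"
      unfolding spherical_geodesic_def using st by blast
    then show ?thesis using geo[OF S0 \<open>m \<in> S\<close> not_antipodal_0] by blast
  qed
  show ?thesis
  proof (rule convexI)
    fix p q :: complex and a t :: real
    assume pq: "p \<in> S" "q \<in> S" and at: "0 \<le> a" "0 \<le> t" "a + t = 1"
    define m where "m = of_real a * p + of_real t * q"
    show "a *\<^sub>R p + t *\<^sub>R q \<in> S"
    proof (cases "antipodal (Some p) (Some q)")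
      case True
      \<comment> \<open>The segment between antipodal points passes through \<open>0\<close>, so star-shapedness suffices.\<close>
      define \<kappa> where "\<kappa> = (1 + (cmod q)\<^sup>2) / (1 + (cmod p)\<^sup>2)"
      have k: "\<kappa> > 0" by (simp add: \<kappa>_def one_plus_cmod_sq_pos)
      define A B where "A = 1 + (cmod p)\<^sup>2" and "B = 1 + (cmod q)\<^sup>2"
      have "of_real B \<noteq> (0::complex)"
        using one_plus_cmod_sq_pos unfolding B_def by (metis less_irrefl of_real_eq_0_iff)
      then have "q = of_real B * (2 * q / of_real B) / 2" by simp
      also have "2 * q / of_real B = - (2 * p / of_real A)"
        using True by (simp add: antipodal_def stereographic_def A_def B_def)
      finally have q: "q = - of_real \<kappa> * p"
        unfolding \<kappa>_def A_def[symmetric] B_def[symmetric] by simp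
      show ?thesis
      proof (cases "a \<ge> t * \<kappa>")
        case True
        have "a *\<^sub>R p + t *\<^sub>R q = of_real (a - t * \<kappa>) * p"
          unfolding q by (simp add: scaleR_conv_of_real algebra_simps)
        moreover have "a - t * \<kappa> \<le> 1" using at k by (smt (verit) mult_nonneg_nonneg)
        ultimately show ?thesis using star[OF pq(1), of "a - t * \<kappa>"] True by simp
      next
        case False
        have "p = - of_real (1/\<kappa>) * q" unfolding q using k by simp
        then have "a *\<^sub>R p + t *\<^sub>R q = of_real (t - a / \<kappa>) * q"
          by (simp add: scaleR_conv_of_real algebra_simps)
        moreover have "t - a / \<kappa> \<le> 1" using at k by (smt (verit) divide_nonneg_pos)
        moreover have "t - a / \<kappa> \<ge> 0" using False k by (simp add: field_simps)
        ultimately show ?thesis using star[OF pq(2), of "t - a / \<kappa>"] by simp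
      qed
    next
      case False
      \<comment> \<open>Give \<open>p\<close> and \<open>q\<close> the weights \<open>a (1 + \<bar>p\<bar>\<^sup>2)\<close> and \<open>t (1 + \<bar>q\<bar>\<^sup>2)\<close>: the combination of their
        stereographic images is \<open>(2 m, v - 1)\<close>, a vector of norm \<open>N\<close> whose first component points
        along \<open>m\<close>. The point of the geodesic that it determines is \<open>\<nu> m\<close> with \<open>\<nu> \<ge> 1\<close>.\<close>
      define v where "v = a * (cmod p)\<^sup>2 + t * (cmod q)\<^sup>2"
      have vm: "v - (cmod m)\<^sup>2 = a * t * (cmod (p - q))\<^sup>2"
      proof -
        have a: "a = 1 - t" using at by simp
        show ?thesis unfolding v_def m_def a cmod_power2
          by (simp add: power2_eq_square algebra_simps)
      qed
      then have vm: "v \<ge> (cmod m)\<^sup>2" using at by (smt (verit) mult_nonneg_nonneg zero_le_power2)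
      show ?thesis
      proof (cases "m = 0")
        case True
        then show ?thesis using S0 by (simp add: m_def scaleR_conv_of_real)
      next
        case m0: False
        define N where "N = sqrt (4 * (cmod m)\<^sup>2 + (v - 1)\<^sup>2)"
        have N2: "N\<^sup>2 = 4 * (cmod m)\<^sup>2 + (v - 1)\<^sup>2" by (simp add: N_def)
        have "(v-1)\<^sup>2 < N\<^sup>2" using m0 N2 by simp
        then have "\<bar>v - 1\<bar> < N" by (metis N_def abs_ge_zero power2_abs power2_less_imp_less real_sqrt_ge_zero add_nonneg_nonneg zero_le_power2 mult_nonneg_nonneg zero_le_numeral)
        then have N: "N - v + 1 > 0" "N > 0" by auto
        have "N\<^sup>2 \<le> (v + 1)\<^sup>2" using vm unfolding N2 by (simp add: power2_eq_square algebra_simps)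
        moreover have "v + 1 \<ge> 0" using vm by (smt (verit) zero_le_power2)
        ultimately have Nv: "N \<le> v + 1" by (rule power2_le_imp_le)
        define \<nu> where "\<nu> = 2 / (N - v + 1)"
        have l1: "\<nu> \<ge> 1" "\<nu> > 0" using N Nv by (auto simp: \<nu>_def)
        define c where "c = of_real \<nu> * m"
        have cc: "(cmod c)\<^sup>2 = (N + v - 1) / (N - v + 1)"
        proof -
          have "(cmod c)\<^sup>2 = 4 * (cmod m)\<^sup>2 / (N - v + 1)\<^sup>2"
            using N unfolding c_def \<nu>_def norm_mult norm_of_real by (simp add: power_mult_distrib power_divide)
          also have "4 * (cmod m)\<^sup>2 = (N + v - 1) * (N - v + 1)"
            using N2 by (simp add: algebra_simps power2_eq_square)
          finally show ?thesis using N by (simp add: power2_eq_square)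
        qed
        have c1: "1 + (cmod c)\<^sup>2 = N * \<nu>" "(cmod c)\<^sup>2 + 1 = N * \<nu>" "(cmod c)\<^sup>2 - 1 = (v - 1) * \<nu>"
          unfolding cc \<nu>_def using N by (simp_all add: field_simps)
        have A: "a * (1 + (cmod p)\<^sup>2) / N * (((cmod p)\<^sup>2 - 1) / ((cmod p)\<^sup>2 + 1)) = a * ((cmod p)\<^sup>2 - 1) / N" for a p
        proof -
          have "(cmod p)\<^sup>2 + 1 \<noteq> 0" using one_plus_cmod_sq_pos[of p] by simp
          then show ?thesis using N by (simp add: add.commute)
        qed
        have B: "(a * (1 + (cmod p)\<^sup>2) / N) *\<^sub>R (2 * p / of_real (1 + (cmod p)\<^sup>2)) = 2 * (of_real a * p) / of_real N" for a p
        proof -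
          have "of_real (1 + (cmod p)\<^sup>2) \<noteq> (0::complex)"
            using one_plus_cmod_sq_pos by (metis less_irrefl of_real_eq_0_iff)
          then show ?thesis by (simp add: scaleR_conv_of_real)
        qed
        have "stereographic (Some c) = (2 * m / of_real N, (v - 1) / N)"
          unfolding stereographic_def option.case c1 using N l1 by (simp add: c_def)
        also have "\<dots> = (a * (1 + (cmod p)\<^sup>2) / N) *\<^sub>R stereographic (Some p) + (t * (1 + (cmod q)\<^sup>2) / N) *\<^sub>R stereographic (Some q)"
        proof -
          have "v - 1 = a * ((cmod p)\<^sup>2 - 1) + t * ((cmod q)\<^sup>2 - 1)"
            using at by (simp add: v_def algebra_simps)
          then show ?thesis unfolding stereographic_def option.case scaleR_Pair add_Pair real_scaleR_def A B m_def
            by (simp add: add_divide_distrib distrib_left)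
        qed
        finally have "Some c \<in> spherical_geodesic (Some p) (Some q)"
          unfolding spherical_geodesic_def using at N one_plus_cmod_sq_pos
          by (smt (verit, ccfv_threshold) divide_nonneg_pos mem_Collect_eq mult_nonneg_nonneg)
        then have "c \<in> S" using geo pq False by blast
        moreover have "m = of_real (1 / \<nu>) * c" using l1 by (simp add: c_def)
        ultimately have "m \<in> S" using star[of c "1/\<nu>"] l1 by simp
        then show ?thesis by (simp add: m_def scaleR_conv_of_real)
      qed
    qed
  qed
qed

text \<open>The chart at \<open>w\<close> preserves geodesics and puts the point \<open>w\<close> of the set at \<open>0\<close>, so it gives a
  geodesically closed set containing \<open>0\<close>.\<close>
lemma convex_chart:
  assumes geo: "geodesically_closed \<Omega>"
    and w: "Some w \<in> \<Omega>"
  shows "convex {p. moebius_sphere 1 w (- cnj w) 1 (Some p) \<in> \<Omega>}"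
proof (rule convex_if_geodesically_closed)
  show "0 \<in> {p. moebius_sphere 1 w (- cnj w) 1 (Some p) \<in> \<Omega>}"
    using w by (simp add: moebius_sphere_def)
next
  fix p q c
  let ?T = "\<lambda>p. moebius_sphere 1 w (- cnj w) 1 (Some p)"
  assume pq: "p \<in> {p. ?T p \<in> \<Omega>}" "q \<in> {p. ?T p \<in> \<Omega>}"
    and na: "\<not> antipodal (Some p) (Some q)" and c: "Some c \<in> spherical_geodesic (Some p) (Some q)"
  interpret linear "sphere_rotation w" by (rule sphere_rotation_linear)
  obtain s t where st: "0 \<le> s" "0 \<le> t"
      "stereographic (Some c) = s *\<^sub>R stereographic (Some p) + t *\<^sub>R stereographic (Some q)"
    using c by (auto simp: spherical_geodesic_def)
  have "stereographic (?T c) = s *\<^sub>R stereographic (?T p) + t *\<^sub>R stereographic (?T q)"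
    unfolding stereographic_moebius st by (simp add: add scale)
  then have "?T c \<in> spherical_geodesic (?T p) (?T q)" using st by (auto simp: spherical_geodesic_def)
  moreover have "\<not> antipodal (?T p) (?T q)"
  proof
    assume "antipodal (?T p) (?T q)"
    then have "sphere_rotation w (stereographic (Some q)) = sphere_rotation w (- stereographic (Some p))"
      unfolding antipodal_def stereographic_moebius by (simp add: neg)
    then have "stereographic (Some q) = - stereographic (Some p)" by (metis sphere_rotation_inverse)
    then show False using na by (simp add: antipodal_def)
  qed
  ultimately show "c \<in> {p. ?T p \<in> \<Omega>}" using geodesically_closedD[OF geo] pq by blast
qed

text \<open>The geodesics from points near \<open>0\<close> to infinity are rays, and together they sweep out the plane.\<close>
lemma geodesically_closed_0_infinity:
  assumes geo: "geodesically_closed \<Omega>"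
    and inf: "None \<in> \<Omega>" and e: "\<epsilon> > 0" "Some ` ball 0 \<epsilon> \<subseteq> \<Omega>"
  shows "Some c \<in> \<Omega>"
proof (cases "cmod c < \<epsilon>")
  case True
  then show ?thesis using e by auto
next
  case False
  define \<mu> where "\<mu> = \<epsilon> / (2 * cmod c)"
  have c: "cmod c > 0" using False e by linarith
  have m: "0 < \<mu>" "\<mu> < 1" using False e c by (auto simp: \<mu>_def field_simps)
  define b where "b = of_real \<mu> * c"
  have "cmod b < \<epsilon>" using m c e by (simp add: b_def norm_mult) (simp add: \<mu>_def)
  then have b: "Some b \<in> \<Omega>" using e by auto
  have b0: "b \<noteq> 0" using m c by (auto simp: b_def)
  have na: "\<not> antipodal (Some b) None"
  proof
    assume "antipodal (Some b) None"
    then have "2 * b / of_real (1 + (cmod b)\<^sup>2) = 0" by (simp add: antipodal_def stereographic_def)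
    moreover have "of_real (1 + (cmod b)\<^sup>2) \<noteq> (0::complex)"
      using one_plus_cmod_sq_pos by (metis less_irrefl of_real_eq_0_iff)
    ultimately show False using b0 by (simp del: of_real_add)
  qed
  define n where "n = (cmod c)\<^sup>2"
  have n: "n \<ge> 0" by (simp add: n_def)
  have bn: "(cmod b)\<^sup>2 = \<mu>\<^sup>2 * n" by (simp add: b_def n_def norm_mult power_mult_distrib)
  define t where "t = (1 + \<mu>\<^sup>2 * n) / (\<mu> * (1 + n))"
  define s where "s = (1 - \<mu>) * (1 + \<mu> * n) / (\<mu> * (1 + n))"
  have st: "s \<ge> 0" "t \<ge> 0" using m n by (auto simp: s_def t_def)
  have 0: "1 + \<mu>\<^sup>2 * n > 0" using n by (simp add: add_pos_nonneg)
  have 1: "2 * c / of_real (1 + n) = t *\<^sub>R (2 * b / of_real (1 + \<mu>\<^sup>2 * n))"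
  proof -
    have "of_real (1 + \<mu>\<^sup>2 * n) \<noteq> (0::complex)" using 0 by (metis less_irrefl of_real_eq_0_iff)
    then show ?thesis using m by (simp add: t_def b_def scaleR_conv_of_real del: of_real_add)
  qed
  have 2: "(n - 1) / (n + 1) = s + t * ((\<mu>\<^sup>2 * n - 1) / (\<mu>\<^sup>2 * n + 1))"
  proof -
    have "t * ((\<mu>\<^sup>2 * n - 1) / (\<mu>\<^sup>2 * n + 1)) = (\<mu>\<^sup>2 * n - 1) / (\<mu> * (1 + n))"
      using 0 by (simp add: t_def add.commute)
    then have "s + t * ((\<mu>\<^sup>2 * n - 1) / (\<mu>\<^sup>2 * n + 1)) = ((1 - \<mu>) * (1 + \<mu> * n) + (\<mu>\<^sup>2 * n - 1)) / (\<mu> * (1 + n))"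
      by (simp add: s_def add_divide_distrib)
    also have "(1 - \<mu>) * (1 + \<mu> * n) + (\<mu>\<^sup>2 * n - 1) = \<mu> * (n - 1)"
      by (simp add: algebra_simps power2_eq_square)
    finally show ?thesis using m by (simp add: add.commute)
  qed
  have "stereographic (Some c) = t *\<^sub>R stereographic (Some b) + s *\<^sub>R stereographic None"
    unfolding stereographic_def option.case bn n_def[symmetric] 1 2 by simp
  then have "Some c \<in> spherical_geodesic (Some b) None" using st by (auto simp: spherical_geodesic_def)
  then show ?thesis using geodesically_closedD[OF geo b inf na] by blast
qed

text \<open>The great circle through \<open>0\<close>, \<open>w\<close> and infinity also contains the antipode \<open>w'\<close> of \<open>w\<close>. A point \<open>b\<close>
  slightly beyond \<open>w\<close> is joined to \<open>w'\<close> by the arc of this circle that passes through infinity.\<close>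
lemma geodesically_closed_antipodal:
  assumes geo: "geodesically_closed \<Omega>"
    and e: "\<epsilon> > 0" "Some ` ball w \<epsilon> \<subseteq> \<Omega>"
    and w': "Some w' \<in> \<Omega>" "antipodal (Some w) (Some w')"
  shows "None \<in> \<Omega>"
proof -
  have w0: "w \<noteq> 0" using w'(2) not_antipodal_0 by blast
  define \<delta> where "\<delta> = \<epsilon> / (2 * cmod w)"
  have d: "\<delta> > 0" using e w0 by (simp add: \<delta>_def)
  define b where "b = of_real (1 + \<delta>) * w"
  have "dist w b = \<delta> * cmod w" using d by (simp add: b_def dist_norm algebra_simps norm_mult)
  also have "\<dots> < \<epsilon>" using e w0 by (simp add: \<delta>_def)
  finally have b: "Some b \<in> \<Omega>" using e by auto
  define n where "n = (cmod w)\<^sup>2"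
  have n: "n > 0" using w0 by (simp add: n_def)
  have A': "stereographic (Some w') = (- (2 * w / of_real (1 + n)), - ((n - 1) / (1 + n)))"
    using w'(2) by (simp add: antipodal_def stereographic_def n_def add.commute)
  define N where "N = 1 + (1 + \<delta>)\<^sup>2 * n"
  have N: "N > 0" using n by (simp add: N_def add_pos_nonneg)
  have "(cmod b)\<^sup>2 = N - 1" using d by (simp add: b_def N_def n_def norm_mult power_mult_distrib del: of_real_add)
  then have A: "stereographic (Some b) = (2 * of_real (1 + \<delta>) * w / of_real N, (N - 2) / N)"
    by (simp add: stereographic_def b_def)
  \<comment> \<open>The weights \<open>N\<close> at \<open>b\<close> and \<open>(1 + \<delta>) (1 + n)\<close> at \<open>w'\<close> cancel the first components of the
    stereographic images and leave \<open>k\<close> in the second, so they are divided by \<open>k\<close>.\<close>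
  define k where "k = \<delta> * (1 + (1 + \<delta>) * n)"
  have k: "k > 0" using d n by (simp add: k_def add_pos_pos)
  have kN: "k = (N - 2) - (1 + \<delta>) * (n - 1)"
    by (simp add: k_def N_def algebra_simps power2_eq_square)
  define s where "s = N / k"
  define t where "t = (1 + \<delta>) * (1 + n) / k"
  have st: "s \<ge> 0" "t \<ge> 0" using N k d n by (auto simp: s_def t_def)
  have c0: "of_real N \<noteq> (0::complex)" "of_real (1 + n) \<noteq> (0::complex)" "of_real k \<noteq> (0::complex)"
    using N n k by (metis less_irrefl of_real_eq_0_iff add_pos_pos zero_less_one)+
  have 1: "s *\<^sub>R (2 * of_real (1 + \<delta>) * w / of_real N) + t *\<^sub>R (- (2 * w / of_real (1 + n))) = 0"
    using c0 unfolding s_def t_def scaleR_conv_of_real of_real_divide of_real_mult by simp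
  have 2: "s * ((N - 2) / N) + t * (- ((n - 1) / (1 + n))) = 1"
  proof -
    have "s * ((N - 2) / N) + t * (- ((n - 1) / (1 + n))) = (N - 2) / k - (1 + \<delta>) * (n - 1) / k"
      using N n by (simp add: s_def t_def)
    also have "\<dots> = 1" using k unfolding diff_divide_distrib[symmetric] kN[symmetric] by simp
    finally show ?thesis .
  qed
  have "stereographic None = s *\<^sub>R stereographic (Some b) + t *\<^sub>R stereographic (Some w')"
    unfolding A A' scaleR_Pair add_Pair 1 real_scaleR_def 2 by (simp add: stereographic_def)
  then have *: "None \<in> spherical_geodesic (Some b) (Some w')"
    using st by (auto simp: spherical_geodesic_def)
  have "\<not> antipodal (Some b) (Some w')"
  proof
    assume "antipodal (Some b) (Some w')"
    then have eq: "stereographic (Some b) = - stereographic (Some w')" by (simp add: antipodal_def)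
    have "stereographic None = (t - s) *\<^sub>R stereographic (Some w')"
      unfolding \<open>stereographic None = _\<close> eq by (simp add: algebra_simps)
    then have "(0, 1) = (t - s) *\<^sub>R (- (2 * w / of_real (1 + n)), - ((n - 1) / (1 + n)))"
      unfolding A' by (simp add: stereographic_def)
    then have "(t - s) *\<^sub>R (- (2 * w / of_real (1 + n))) = 0" "t - s \<noteq> 0"
      by (auto simp: scaleR_Pair simp del: of_real_add)
    then show False using w0 c0(2) by (simp del: of_real_add)
  qed
  then show ?thesis using * geodesically_closedD[OF geo b w'(1)] by blast
qed

text \<open>The cone over \<open>\<Omega>\<close> in \<open>\<real>\<^sup>3\<close> is convex, because geodesics are the radial projections of segments,
  and without antipodal pairs no segment of the cone meets \<open>0\<close>; so a plane separates it from \<open>0\<close>.\<close>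
lemma geodesically_closed_in_hemisphere:
  assumes geo: "geodesically_closed \<Omega>"
    and na: "\<And>p q. p \<in> \<Omega> \<Longrightarrow> q \<in> \<Omega> \<Longrightarrow> \<not> antipodal p q"
  obtains a where "a \<noteq> 0" "\<And>p. p \<in> \<Omega> \<Longrightarrow> 0 \<le> a \<bullet> stereographic p"
proof -
  define C where "C = {k *\<^sub>R stereographic p | k p. k > 0 \<and> p \<in> \<Omega>}"
  have n0: "stereographic p \<noteq> 0" for p by (metis norm_stereographic norm_zero zero_neq_one)
  have "convex C"
  proof (rule convexI)
    fix x y and u v :: real
    assume xy: "x \<in> C" "y \<in> C" and uv: "0 \<le> u" "0 \<le> v" "u + v = 1"
    obtain k p where x: "x = k *\<^sub>R stereographic p" "k > 0" "p \<in> \<Omega>" using xy by (auto simp: C_def)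
    obtain l q where y: "y = l *\<^sub>R stereographic q" "l > 0" "q \<in> \<Omega>" using xy by (auto simp: C_def)
    define s t where "s = u * k" and "t = v * l"
    have st: "s \<ge> 0" "t \<ge> 0" using uv x y by (auto simp: s_def t_def)
    have pos: "s > 0 \<or> t > 0" using uv x y by (auto simp: s_def t_def zero_less_mult_iff)
    define z where "z = s *\<^sub>R stereographic p + t *\<^sub>R stereographic q"
    have "z \<noteq> 0"
    proof
      assume "z = 0"
      then have e: "s *\<^sub>R stereographic p = - (t *\<^sub>R stereographic q)" by (simp add: z_def add_eq_0_iff2)
      have "norm (s *\<^sub>R stereographic p) = norm (t *\<^sub>R stereographic q)" unfolding e by simp
      then have "s = t" using st by (simp add: norm_stereographic)
      then have "stereographic p = - stereographic q" using e pos by (metis less_irrefl scaleR_cancel_left scaleR_minus_right)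
      then show False using na[OF x(3) y(3)] by (simp add: antipodal_def)
    qed
    then obtain c where c: "stereographic c = z /\<^sub>R norm z" using stereographic_surj[of "z /\<^sub>R norm z"] by auto
    have "stereographic c = (s / norm z) *\<^sub>R stereographic p + (t / norm z) *\<^sub>R stereographic q"
      unfolding c by (simp add: z_def algebra_simps divide_inverse)
    then have "c \<in> spherical_geodesic p q" using st
      unfolding spherical_geodesic_def by (metis (mono_tags, lifting) divide_nonneg_nonneg mem_Collect_eq norm_ge_zero)
    then have "c \<in> \<Omega>" using geodesically_closedD[OF geo x(3) y(3) na[OF x(3) y(3)]] by blast
    moreover have "z = norm z *\<^sub>R stereographic c" unfolding c using \<open>z \<noteq> 0\<close> by simp
    ultimately have "z \<in> C" unfolding C_def using \<open>z \<noteq> 0\<close> by (metis (mono_tags, lifting) mem_Collect_eq zero_less_norm_iff)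
    moreover have "u *\<^sub>R x + v *\<^sub>R y = z" by (simp add: x y z_def s_def t_def)
    ultimately show "u *\<^sub>R x + v *\<^sub>R y \<in> C" by simp
  qed
  moreover have "0 \<notin> C" using n0 by (auto simp: C_def)
  ultimately obtain a where a: "a \<noteq> 0" "\<forall>x\<in>C. 0 \<le> a \<bullet> x" using separating_hyperplane_set_0 by blast
  have "0 \<le> a \<bullet> stereographic p" if "p \<in> \<Omega>" for p
  proof -
    have "stereographic p \<in> C" unfolding C_def using that by (smt (verit, best) mem_Collect_eq scaleR_one zero_less_one)
    then show ?thesis using a by blast
  qed
  then show thesis using that a by blast
qed


section \<open>Circular means\<close>

definition circle_mean :: "real \<Rightarrow> (complex \<Rightarrow> complex) \<Rightarrow> complex" where
  "circle_mean r G = integral {0..2*pi} (\<lambda>t. G (of_real r * cis t)) / (2 * pi)"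

lemma circle_mean_contour:
  assumes "r > 0"
  shows "contour_integral (circlepath 0 r) (\<lambda>z. G z / z) = 2 * pi * \<i> * circle_mean r G"
proof -
  have "contour_integral (circlepath 0 r) (\<lambda>z. G z / z)
      = integral {0..2*pi} (\<lambda>t. G (of_real r * cis t) / (of_real r * cis t) * r * \<i> * cis t)"
    unfolding circlepath_def by (subst contour_integral_part_circlepath_eq) auto
  also have "\<dots> = integral {0..2*pi} (\<lambda>t. \<i> * G (of_real r * cis t))"
    using assms by (intro integral_cong) (auto simp: field_simps)
  finally show ?thesis by (simp add: circle_mean_def)
qed

lemma circle_mean_holomorphic:
  assumes "G holomorphic_on ball 0 1" "0 < r" "r < 1"
  shows "circle_mean r G = G 0"
proof -
  have "G holomorphic_on cball 0 r" using assms by (auto intro: holomorphic_on_subset)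
  then have "((\<lambda>u. G u / (u - 0)) has_contour_integral (2 * of_real pi * \<i> * G 0)) (circlepath 0 r)"
    using assms by (intro Cauchy_integral_circlepath_simple) auto
  then have "2 * pi * \<i> * circle_mean r G = 2 * of_real pi * \<i> * G 0"
    using circle_mean_contour[OF assms(2), of G] by (simp add: contour_integral_unique)
  then show ?thesis by simp
qed

text \<open>Concentric circles in the annulus are homotopic there, by moving each point along its radius.\<close>
lemma circle_mean_radius_independent:
  assumes hol: "G holomorphic_on (ball 0 1 - cball 0 s)" and s: "0 \<le> s" "s < r" "r < 1" "s < R" "R < 1"
  shows "circle_mean r G = circle_mean R G"
proof -
  define A :: "complex set" where "A = ball 0 1 - cball 0 s"
  have op: "open A" by (simp add: A_def open_Diff)
  have "(\<lambda>z. G z / z) holomorphic_on A"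
    using hol s unfolding A_def by (intro holomorphic_intros) auto
  moreover have "homotopic_loops A (circlepath 0 r) (circlepath 0 R)"
  proof (rule homotopic_loops_linear)
    fix t :: real
    show "closed_segment (circlepath 0 r t) (circlepath 0 R t) \<subseteq> A"
    proof
      fix x assume "x \<in> closed_segment (circlepath 0 r t) (circlepath 0 R t)"
      then obtain u where u: "0 \<le> u" "u \<le> 1" "x = (1 - u) *\<^sub>R circlepath 0 r t + u *\<^sub>R circlepath 0 R t"
        by (auto simp: closed_segment_def)
      define v where "v = (1 - u) * r + u * R"
      have x: "x = of_real v * exp (2 * of_real pi * \<i> * of_real t)"
        unfolding u(3) v_def by (simp add: circlepath scaleR_conv_of_real algebra_simps)
      have "s < v" unfolding v_def using convex_bound_lt[of "-r" "-s" "-R" "1 - u" u] s u by simp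
      moreover have "v < 1" unfolding v_def using s u by (intro convex_bound_lt) auto
      moreover have "cmod x = v" unfolding x norm_mult using \<open>s < v\<close> s
        by (simp add: norm_exp_eq_Re)
      ultimately show "x \<in> A" by (simp add: A_def)
    qed
  qed auto
  ultimately have "contour_integral (circlepath 0 r) (\<lambda>z. G z / z) = contour_integral (circlepath 0 R) (\<lambda>z. G z / z)"
    using op by (intro Cauchy_theorem_homotopic_loops) auto
  then show ?thesis using circle_mean_contour[of r G] circle_mean_contour[of R G] s by simp
qed

section \<open>Convex maps of the disc\<close>

text \<open>The idea is Study's proof that a convex map sends discs about \<open>0\<close> to convex sets. By convexity
  \<open>(1 - t) g(x) + t g(e x)\<close> stays in the image of \<open>g\<close>, so composing with the inverse of \<open>g\<close> gives a
  self-map of the disc fixing \<open>0\<close>, and by Schwarz's lemma it does not increase \<open>\<bar>z\<bar>\<close>. At \<open>t = 0\<close> it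
  is the identity, and the inequality is the sign of the derivative of its squared modulus there.\<close>
lemma convex_map_two_points:
  assumes hol: "g holomorphic_on ball 0 1" and inj: "inj_on g (ball 0 1)" and conv: "convex (g ` ball 0 1)"
    and z: "cmod z < 1" and e: "cmod e = 1"
  shows "Re (cnj z * (g (e * z) - g z) / deriv g z) \<le> 0"
proof -
  obtain h where h: "h holomorphic_on (g ` ball 0 1)"
      "\<And>z. z \<in> ball 0 1 \<Longrightarrow> deriv g z * deriv h (g z) = 1"
      "\<And>z. z \<in> ball 0 1 \<Longrightarrow> h (g z) = z"
    using holomorphic_has_inverse[OF hol open_ball inj] by metis
  have op: "open (g ` ball 0 1)" by (rule open_mapping_thm3[OF hol open_ball inj])
  have bound: "cmod (h ((1 - t) *\<^sub>R g z + t *\<^sub>R g (e * z))) \<le> cmod z" if t: "0 \<le> t" "t \<le> 1" for t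
  proof -
    define \<phi> where "\<phi> = (\<lambda>x. (1 - t) *\<^sub>R g x + t *\<^sub>R g (e * x))"
    have "(\<lambda>x. g (e * x)) holomorphic_on ball 0 1"
      using e by (intro holomorphic_on_compose_gen[OF _ hol, unfolded o_def]) (auto intro!: holomorphic_intros simp: norm_mult)
    then have h1: "\<phi> holomorphic_on ball 0 1"
      unfolding \<phi>_def scaleR_conv_of_real by (intro holomorphic_intros hol)
    have im: "\<phi> x \<in> g ` ball 0 1" if "x \<in> ball 0 1" for x
      unfolding \<phi>_def using that t e by (intro convexD_alt[OF conv]) (auto simp: norm_mult)
    have "(h \<circ> \<phi>) holomorphic_on ball 0 1"
      using im by (intro holomorphic_on_compose_gen[OF h1 h(1)]) auto
    moreover have "\<phi> 0 = g 0" by (simp add: \<phi>_def algebra_simps flip: scaleR_left_distrib)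
    then have "(h \<circ> \<phi>) 0 = 0" using h(3)[of 0] by simp
    moreover have "cmod ((h \<circ> \<phi>) x) < 1" if "cmod x < 1" for x
    proof -
      have "\<phi> x \<in> g ` ball 0 1" using im[of x] that by simp
      then obtain y where "y \<in> ball 0 1" "\<phi> x = g y" by blast
      then show ?thesis using h(3)[of y] by simp
    qed
    ultimately have "cmod ((h \<circ> \<phi>) z) \<le> cmod z" using z by (intro Schwarz_Lemma(1)) blast+
    then show ?thesis by (simp add: \<phi>_def)
  qed
  define \<omega> where "\<omega> = (\<lambda>t::real. h (g z + of_real t * (g (e * z) - g z)))"
  have gz: "g z \<in> g ` ball 0 1" using z by auto
  have dg: "deriv g z \<noteq> 0" using h(2)[of z] z by auto
  have dh: "deriv h (g z) = 1 / deriv g z" using h(2)[of z] z dg by (simp add: field_simps)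
  have "(h has_field_derivative 1 / deriv g z) (at (g z + of_real 0 * (g (e * z) - g z)))"
    using holomorphic_derivI[OF h(1) op gz] dh by simp
  moreover have "((\<lambda>x. g z + x * (g (e * z) - g z)) has_field_derivative (g (e * z) - g z)) (at (of_real 0))"
    by (auto intro!: derivative_eq_intros)
  ultimately have "((\<lambda>x. h (g z + x * (g (e * z) - g z))) has_field_derivative (1 / deriv g z * (g (e * z) - g z))) (at (of_real 0))"
    by (rule DERIV_chain2)
  then have w': "(\<omega> has_vector_derivative (1 / deriv g z * (g (e * z) - g z))) (at 0)"
    unfolding \<omega>_def by (rule has_vector_derivative_real_field)
  define c where "c = (g (e * z) - g z) / deriv g z"
  define u where "u = (\<lambda>t. \<omega> t \<bullet> \<omega> t)"
  have w0: "\<omega> 0 = z" using h(3)[of z] z by (simp add: \<omega>_def)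
  have "(u has_vector_derivative (\<omega> 0 \<bullet> c + c \<bullet> \<omega> 0)) (at 0)"
    unfolding u_def using bounded_bilinear.has_vector_derivative[OF bounded_bilinear_inner w' w'] by (simp add: c_def)
  then have u': "(u has_real_derivative (2 * (z \<bullet> c))) (at 0)"
    unfolding w0 by (simp add: has_real_derivative_iff_has_vector_derivative inner_commute)
  have "z \<bullet> c \<le> 0"
  proof (rule ccontr)
    assume "\<not> ?thesis"
    then have "0 < 2 * (z \<bullet> c)" by simp
    then obtain d where d: "d > 0" "\<forall>h>0. h < d \<longrightarrow> u 0 < u (0 + h)"
      using DERIV_pos_inc_right[OF u'] by blast
    define t where "t = min (d/2) 1"
    have t: "0 < t" "t < d" "t \<le> 1" using d by (auto simp: t_def)
    then have "u 0 < u t" using d by auto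
    moreover have "\<omega> t = h ((1 - t) *\<^sub>R g z + t *\<^sub>R g (e * z))"
      by (simp add: \<omega>_def scaleR_conv_of_real algebra_simps)
    then have "cmod (\<omega> t) \<le> cmod z" using bound[of t] t by simp
    then have "u t \<le> u 0" unfolding u_def w0 by (simp add: dot_square_norm power_mono)
    ultimately show False by simp
  qed
  moreover have "z \<bullet> c = Re (cnj z * c)" by (simp add: inner_complex_def)
  ultimately show ?thesis by (simp add: c_def)
qed

section \<open>Holomorphic functions with nonnegative real part\<close>

text \<open>Schwarz's lemma after mapping \<open>0\<close> to \<open>x\<close> in the disc and \<open>P x\<close> to \<open>0\<close> from the right half plane.
  Adding \<open>\<epsilon> > 0\<close> to \<open>P\<close> first makes its real part strictly positive.\<close>
lemma half_plane_Schwarz_Pick: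
  assumes hol: "P holomorphic_on ball 0 1" and pos: "\<And>q. cmod q < 1 \<Longrightarrow> 0 \<le> Re (P q)"
    and x: "0 \<le> x" "x < 1"
  shows "cmod (deriv P (of_real x)) \<le> 2 * Re (P (of_real x)) / (1 - x\<^sup>2)"
proof -
  have x2: "0 < 1 - x\<^sup>2" using x by (simp add: power_less_one_iff abs_square_less_1)
  have *: "cmod (deriv P (of_real x)) * (1 - x\<^sup>2) \<le> 2 * (Re (P (of_real x)) + \<epsilon>)" if e: "\<epsilon> > 0" for \<epsilon> :: real
  proof -
    define p where "p = P (of_real x) + of_real \<epsilon>"
    have rp: "Re p > 0" using pos[of "of_real x"] x e by (simp add: p_def)
    define \<phi> where "\<phi> = (\<lambda>y. (y + of_real x) / (1 + of_real x * y) :: complex)"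
    have nz: "1 + of_real x * y \<noteq> 0" if "cmod y < 1" for y
    proof
      assume "1 + of_real x * y = 0"
      then have "of_real x * y = -1" by (simp add: eq_neg_iff_add_eq_0 add.commute)
      then have "cmod (of_real x * y) = 1" by simp
      then have "x * cmod y = 1" using x by (simp add: norm_mult)
      moreover have "x * cmod y \<le> 1 * cmod y" using x by (intro mult_right_mono) auto
      ultimately show False using that by simp
    qed
    have im: "cmod (\<phi> y) < 1" if "cmod y < 1" for y
    proof -
      have "(cmod (1 + of_real x * y))\<^sup>2 - (cmod (y + of_real x))\<^sup>2 = (1 - x\<^sup>2) * (1 - (cmod y)\<^sup>2)"
        unfolding cmod_power2 by (simp add: power2_eq_square algebra_simps)
      also have "\<dots> > 0" using x2 that by (simp add: abs_square_less_1)
      finally have "cmod (y + of_real x) < cmod (1 + of_real x * y)" by (simp add: power2_less_imp_less)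
      then show ?thesis unfolding \<phi>_def norm_divide using nz[OF that] by simp
    qed
    define Q where "Q = (\<lambda>y. P (\<phi> y) + of_real \<epsilon>)"
    have rQ: "Re (Q y) > 0" if "cmod y < 1" for y using pos[OF im[OF that]] e by (simp add: Q_def)
    define w where "w = (\<lambda>y. (Q y - p) / (Q y + cnj p))"
    have nzQ: "Q y + cnj p \<noteq> 0" if "cmod y < 1" for y
    proof
      assume "Q y + cnj p = 0"
      then have "Re (Q y + cnj p) = 0" by simp
      then show False using rQ[OF that] rp by simp
    qed
    have hp: "\<phi> holomorphic_on ball 0 1" unfolding \<phi>_def using nz by (intro holomorphic_intros) auto
    have "(P \<circ> \<phi>) holomorphic_on ball 0 1"
      using im by (intro holomorphic_on_compose_gen[OF hp hol]) auto
    then have hQ: "Q holomorphic_on ball 0 1" unfolding Q_def o_def by (intro holomorphic_intros)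
    have hw: "w holomorphic_on ball 0 1" unfolding w_def using nzQ by (intro holomorphic_intros hQ) auto
    have Q0: "Q 0 = p" by (simp add: Q_def p_def \<phi>_def)
    have "cmod (w y) < 1" if "cmod y < 1" for y
    proof -
      have "(cmod (Q y + cnj p))\<^sup>2 - (cmod (Q y - p))\<^sup>2 = 4 * Re (Q y) * Re p"
        unfolding cmod_power2 by (simp add: power2_eq_square algebra_simps)
      also have "\<dots> > 0" using rp rQ[OF that] by simp
      finally have "cmod (Q y - p) < cmod (Q y + cnj p)" by (simp add: power2_less_imp_less)
      then show ?thesis unfolding w_def norm_divide using nzQ[OF that] by simp
    qed
    moreover have "w 0 = 0" by (simp add: w_def Q0)
    ultimately have "cmod (deriv w 0) \<le> 1" using hw by (intro Schwarz_Lemma(2)[of w 0]) auto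
    have "(\<phi> has_field_derivative of_real (1 - x\<^sup>2)) (at 0)"
      unfolding \<phi>_def by (auto intro!: derivative_eq_intros simp: power2_eq_square)
    moreover have "(P has_field_derivative deriv P (of_real x)) (at (\<phi> 0))"
      using holomorphic_derivI[OF hol open_ball, of "of_real x"] x by (simp add: \<phi>_def)
    ultimately have "((\<lambda>y. P (\<phi> y)) has_field_derivative deriv P (of_real x) * of_real (1 - x\<^sup>2)) (at 0)"
      by (rule DERIV_chain2[rotated])
    then have dQ: "(Q has_field_derivative deriv P (of_real x) * of_real (1 - x\<^sup>2)) (at 0)"
      unfolding Q_def by (auto intro!: derivative_eq_intros)
    have pp: "p + cnj p = of_real (2 * Re p)" by (simp add: complex_add_cnj)
    have "(w has_field_derivative (deriv P (of_real x) * of_real (1 - x\<^sup>2)) / of_real (2 * Re p)) (at 0)"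
    proof -
      define D where "D = deriv P (of_real x) * of_real (1 - x\<^sup>2)"
      have "((\<lambda>y. Q y - p) has_field_derivative D) (at 0)" "((\<lambda>y. Q y + cnj p) has_field_derivative D) (at 0)"
        using dQ by (auto intro!: derivative_eq_intros simp: D_def)
      from DERIV_divide[OF this] have "(w has_field_derivative D * (p + cnj p) / ((p + cnj p) * (p + cnj p))) (at 0)"
        using nzQ[of 0] by (simp add: w_def Q0)
      moreover have "p + cnj p \<noteq> 0" using nzQ[of 0] by (simp add: Q0)
      ultimately have "(w has_field_derivative D / (p + cnj p)) (at 0)" by simp
      then show ?thesis by (simp only: D_def pp)
    qed
    then have "deriv w 0 = (deriv P (of_real x) * of_real (1 - x\<^sup>2)) / of_real (2 * Re p)" by (rule DERIV_imp_deriv)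
    then have "cmod (deriv w 0) = cmod (deriv P (of_real x)) * (1 - x\<^sup>2) / (2 * Re p)"
      using x2 rp by (simp add: norm_mult norm_divide del: of_real_diff of_real_power of_real_mult)
    with \<open>cmod (deriv w 0) \<le> 1\<close> have "cmod (deriv P (of_real x)) * (1 - x\<^sup>2) \<le> 2 * Re p"
      using rp by (simp add: field_simps)
    then show ?thesis by (simp add: p_def)
  qed
  have "cmod (deriv P (of_real x)) * (1 - x\<^sup>2) \<le> 2 * Re (P (of_real x))"
  proof (rule field_le_epsilon)
    fix \<epsilon> :: real assume "\<epsilon> > 0"
    then show "cmod (deriv P (of_real x)) * (1 - x\<^sup>2) \<le> 2 * Re (P (of_real x)) + \<epsilon>" using *[of "\<epsilon>/2"] by simp
  qed
  then show ?thesis using x2 by (simp add: field_simps)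
qed

text \<open>The logarithmic derivative of \<open>(1 + x) / (1 - x)\<close> is \<open>2 / (1 - x\<^sup>2)\<close>, which matches the constant in
  the Schwarz-Pick inequality.\<close>
lemma Harnack_has_derivative:
  assumes hol: "P holomorphic_on ball 0 1" and x: "0 \<le> x" "x < 1"
  shows "((\<lambda>x. Re (P (of_real x)) * (1 + x) / (1 - x)) has_real_derivative
     (Re (deriv P (of_real x)) + 2 * Re (P (of_real x)) / (1 - x\<^sup>2)) * ((1 + x) / (1 - x))) (at x)"
proof -
  have "(P has_field_derivative deriv P (of_real x)) (at (of_real x))"
    using x by (intro holomorphic_derivI[OF hol]) auto
  then have "((\<lambda>x. P (of_real x)) has_vector_derivative deriv P (of_real x)) (at x)"
    by (rule has_vector_derivative_real_field)
  then have d: "((\<lambda>x. Re (P (of_real x))) has_real_derivative Re (deriv P (of_real x))) (at x)"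
    by (rule has_field_derivative_Re)
  have nz: "1 - x \<noteq> 0" "1 + x \<noteq> 0" using x by auto
  have f: "1 - x\<^sup>2 = (1 - x) * (1 + x)" by (simp add: algebra_simps power2_eq_square)
  define \<phi> where "\<phi> = (\<lambda>x. Re (P (of_real x)))"
  define \<phi>' where "\<phi>' = Re (deriv P (of_real x))"
  have "(\<phi> has_real_derivative \<phi>') (at x)" using d by (simp add: \<phi>_def \<phi>'_def)
  then have "((\<lambda>x. \<phi> x * (1 + x) / (1 - x)) has_real_derivative
      ((\<phi>' * (1 + x) + \<phi> x) * (1 - x) + \<phi> x * (1 + x)) / ((1 - x) * (1 - x))) (at x)"
    using nz by (auto intro!: derivative_eq_intros)
  also have "((\<phi>' * (1 + x) + \<phi> x) * (1 - x) + \<phi> x * (1 + x)) / ((1 - x) * (1 - x))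
      = (\<phi>' + 2 * \<phi> x / (1 - x\<^sup>2)) * ((1 + x) / (1 - x))"
    unfolding f using nz by (simp add: divide_simps) (simp add: algebra_simps)
  finally show ?thesis by (simp add: \<phi>_def \<phi>'_def)
qed

lemma Harnack_mono:
  assumes hol: "P holomorphic_on ball 0 1" and pos: "\<And>q. cmod q < 1 \<Longrightarrow> 0 \<le> Re (P q)"
    and x: "0 \<le> x" "x \<le> y" "y < 1"
  shows "Re (P (of_real x)) * (1 + x) / (1 - x) \<le> Re (P (of_real y)) * (1 + y) / (1 - y)"
proof (rule DERIV_nonneg_imp_nondecreasing[of x y "\<lambda>x. Re (P (of_real x)) * (1 + x) / (1 - x)"])
  show "x \<le> y" by fact
  fix s assume s: "x \<le> s" "s \<le> y"
  have "- Re (deriv P (of_real s)) \<le> cmod (deriv P (of_real s))"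
    using abs_Re_le_cmod[of "deriv P (of_real s)"] by linarith
  also have "\<dots> \<le> 2 * Re (P (of_real s)) / (1 - s\<^sup>2)"
    using s x by (intro half_plane_Schwarz_Pick[OF hol pos]) auto
  finally have "0 \<le> (Re (deriv P (of_real s)) + 2 * Re (P (of_real s)) / (1 - s\<^sup>2)) * ((1 + s) / (1 - s))"
    using s x by (intro mult_nonneg_nonneg) auto
  then show "\<exists>d. ((\<lambda>x. Re (P (of_real x)) * (1 + x) / (1 - x)) has_real_derivative d) (at s) \<and> 0 \<le> d"
    using Harnack_has_derivative[OF hol, of s] s x by auto
qed

text \<open>Between \<open>x\<close> and \<open>y\<close> the product has a constant value \<open>C\<close>. There \<open>Re P'\<close> is as negative as the
  Schwarz-Pick inequality for \<open>\<bar>P'\<bar>\<close> permits, so \<open>P'\<close> is real and equals \<open>- 2 C / (1 + s)\<^sup>2\<close>. This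
  identity extends to the disc, and the value at \<open>0\<close> leaves only \<open>C = 1\<close>.\<close>
lemma Harnack_equality:
  assumes hol: "P holomorphic_on ball 0 1" and pos: "\<And>q. cmod q < 1 \<Longrightarrow> 0 \<le> Re (P q)"
    and P0: "P 0 = 1"
    and x: "0 \<le> x" "x < y" "y < 1"
    and eq: "Re (P (of_real x)) * (1 + x) / (1 - x) = Re (P (of_real y)) * (1 + y) / (1 - y)"
  shows "deriv P 0 = - 2"
proof -
  define C where "C = Re (P (of_real x)) * (1 + x) / (1 - x)"
  have const: "Re (P (of_real s)) * (1 + s) / (1 - s) = C" if "x \<le> s" "s \<le> y" for s
    using Harnack_mono[OF hol pos, of x s] Harnack_mono[OF hol pos, of s y] that x eq
    unfolding C_def by fastforce
  have C: "Re (P (of_real s)) = C * (1 - s) / (1 + s)" if "x \<le> s" "s \<le> y" for s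
    unfolding const[OF that, symmetric] using that x by simp
  have dP: "deriv P (of_real s) = of_real (- 2 * C / (1 + s)\<^sup>2)" if s: "x < s" "s < y" for s
  proof -
    have s2: "1 - s\<^sup>2 = (1 - s) * (1 + s)" by (simp add: algebra_simps power2_eq_square)
    have b: "2 * Re (P (of_real s)) / (1 - s\<^sup>2) = 2 * C / (1 + s)\<^sup>2"
      using C[of s] s x unfolding s2 by (simp add: power2_eq_square)
    have "((\<lambda>x. Re (P (of_real x)) * (1 + x) / (1 - x)) has_real_derivative 0) (at s)"
    proof (rule has_field_derivative_transform_within_open)
      show "((\<lambda>_. C) has_real_derivative 0) (at s)" by simp
      show "open {x<..<y}" "s \<in> {x<..<y}" using s by auto
    qed (use const in auto)
    then have "(Re (deriv P (of_real s)) + 2 * Re (P (of_real s)) / (1 - s\<^sup>2)) * ((1 + s) / (1 - s)) = 0"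
      using Harnack_has_derivative[OF hol, of s] s x by (intro DERIV_unique) auto
    then have re: "Re (deriv P (of_real s)) = - 2 * C / (1 + s)\<^sup>2" using s x b by simp
    have le: "cmod (deriv P (of_real s)) \<le> 2 * C / (1 + s)\<^sup>2"
      using half_plane_Schwarz_Pick[OF hol pos, of s] b s x by simp
    then have "0 \<le> 2 * C / (1 + s)\<^sup>2" by (meson norm_ge_zero order_trans)
    then have "\<bar>Re (deriv P (of_real s))\<bar> = 2 * C / (1 + s)\<^sup>2" using re by linarith
    then have "cmod (deriv P (of_real s)) \<le> \<bar>Re (deriv P (of_real s))\<bar>" using le by simp
    then have "Im (deriv P (of_real s)) = 0" 
    proof -
      have "(cmod (deriv P (of_real s)))\<^sup>2 \<le> (Re (deriv P (of_real s)))\<^sup>2"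
        using \<open>cmod _ \<le> \<bar>_\<bar>\<close> by (metis abs_norm_cancel abs_le_square_iff)
      then show ?thesis unfolding cmod_power2 by simp
    qed
    then show ?thesis using re by (simp add: complex_eq_iff)
  qed
  have nz: "1 + q \<noteq> 0" if "cmod q < 1" for q :: complex
    using that by (metis add.right_neutral add_cancel_left_right add_eq_0_iff less_irrefl norm_minus_cancel norm_one)
  define m where "m = (x + y) / 2"
  have lim: "(of_real m :: complex) islimpt of_real ` {x<..<y}"
  proof -
    show ?thesis unfolding islimpt_approachable
    proof (intro allI impI)
      fix e :: real assume e: "e > 0"
      define d where "d = min (e / 2) ((y - x) / 4)"
      have "d \<le> (y - x) / 4" unfolding d_def by (rule min.cobounded2)
      then have d: "0 < d" "d < e" "d < (y - x) / 2" using e x by (auto simp: d_def)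
      have "dist (of_real (m + d)) (of_real m :: complex) = d" using d by (simp add: dist_norm)
      moreover have "m + d \<in> {x<..<y}" using d x by (auto simp: m_def field_simps)
      moreover have "of_real (m + d) \<noteq> (of_real m :: complex)" using d by simp
      ultimately show "\<exists>x'\<in>of_real ` {x<..<y}. x' \<noteq> of_real m \<and> dist x' (of_real m :: complex) < e"
        using d by (metis imageI)
    qed
  qed
  have dP': "deriv P q = - 2 * of_real C / (1 + q)\<^sup>2" if q: "cmod q < 1" for q
  proof -
    have "deriv P q + 2 * of_real C / (1 + q)\<^sup>2 = 0"
    proof (rule analytic_continuation[where f = "\<lambda>q. deriv P q + 2 * of_real C / (1 + q)\<^sup>2"
          and S = "ball 0 1" and U = "of_real ` {x<..<y}" and \<xi> = "of_real m"])
      show "(\<lambda>q. deriv P q + 2 * of_real C / (1 + q)\<^sup>2) holomorphic_on ball 0 1"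
        using nz by (intro holomorphic_intros holomorphic_deriv[OF hol]) auto
      show "of_real ` {x<..<y} \<subseteq> ball (0::complex) 1" using x by auto
      have "0 \<le> m" "m < 1" using x by (auto simp: m_def)
      then show "(of_real m::complex) \<in> ball 0 1" by simp
      show "(of_real m :: complex) islimpt of_real ` {x<..<y}" by (rule lim)
      show "deriv P z + 2 * of_real C / (1 + z)\<^sup>2 = 0" if "z \<in> of_real ` {x<..<y}" for z
        using that dP by auto
      show "q \<in> ball 0 1" using q by simp
    qed simp_all
    then show ?thesis by (simp add: add_eq_0_iff2)
  qed
  have "\<exists>c. \<forall>q\<in>ball 0 1. P q - of_real C * (1 - q) / (1 + q) = c"
  proof (rule has_field_derivative_zero_constant)
    fix q :: complex assume q: "q \<in> ball 0 1"
    have n: "1 + q \<noteq> 0" using nz q by simp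
    have "((\<lambda>q. of_real C * (1 - q) / (1 + q)) has_field_derivative - 2 * of_real C / (1 + q)\<^sup>2) (at q)"
      apply (rule derivative_eq_intros refl)+
      using n apply simp
      using n apply (simp add: power2_eq_square algebra_simps)
      done
    then show "((\<lambda>q. P q - of_real C * (1 - q) / (1 + q)) has_field_derivative 0) (at q within ball 0 1)"
      using DERIV_diff[OF holomorphic_derivI[OF hol open_ball q]] dP'[of q] q
      by (metis cancel_comm_monoid_add_class.diff_cancel has_field_derivative_at_within mem_ball_0)
  qed simp
  then obtain c where c: "\<And>q. cmod q < 1 \<Longrightarrow> P q - of_real C * (1 - q) / (1 + q) = c" by auto
  have "c = of_real (1 - C)" using c[of 0] P0 by simp
  moreover have "P (of_real x) = c + of_real (C * (1 - x) / (1 + x))" using c[of "of_real x"] x by (simp add: algebra_simps)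
  then have "Re c = 0" using C[of x] x by simp
  ultimately have "C = 1" by simp
  then show ?thesis using dP'[of 0] by simp
qed


section \<open>The mean kernel\<close>
definition reflect :: "(complex \<Rightarrow> complex) \<Rightarrow> complex \<Rightarrow> complex" where
  "reflect f x = cnj (f (cnj x))"

text \<open>The last assumption says that \<open>f z\<close> is never the antipode of \<open>f \<zeta>\<close>.\<close>
locale antipode_free =
  fixes f :: "complex \<Rightarrow> complex"
  assumes hol: "f holomorphic_on ball 0 1" and f0: "f 0 = 0"
    and antipode_free: "\<And>z \<zeta>. cmod z < 1 \<Longrightarrow> cmod \<zeta> < 1 \<Longrightarrow> 1 + cnj (f \<zeta>) * f z \<noteq> 0"
begin

lemma hol': "deriv f holomorphic_on ball 0 1"
  by (rule holomorphic_deriv[OF hol open_ball])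

lemma reflect_hol: "reflect f holomorphic_on ball 0 1"
proof -
  have "cnj ` ball 0 1 = ball 0 1" by (force simp: image_iff intro: bexI[where x = "cnj x" for x])
  then show ?thesis
    using holomorphic_on_compose_cnj_cnj[of f "ball 0 1"] hol by (simp add: reflect_def[abs_def] o_def)
qed

text \<open>If \<open>\<zeta>\<close> is the point with \<open>cnj \<zeta> = q / z\<close>, then \<open>reflect f (q / z) = cnj (f \<zeta>)\<close>. In this form the
  kernel is holomorphic in \<open>z\<close> as well as in \<open>q\<close>.\<close>
definition kernel :: "complex \<Rightarrow> complex \<Rightarrow> complex" where
  "kernel q z = 2 * z * deriv f z * reflect f (q / z) / (1 + reflect f (q / z) * f z)"

text \<open>Any radius strictly between \<open>\<bar>q\<bar>\<close> and \<open>1\<close> gives the same value (\<open>mean_kernel_eq\<close>).\<close>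
definition mean_kernel :: "complex \<Rightarrow> complex" where
  "mean_kernel q = circle_mean ((1 + cmod q) / 2) (kernel q)"

lemma kernel_denominator: "cmod x < 1 \<Longrightarrow> cmod z < 1 \<Longrightarrow> 1 + reflect f x * f z \<noteq> 0"
  using antipode_free[of z "cnj x"] by (simp add: reflect_def)

lemma kernel_hol:
  assumes "cmod q < 1" shows "kernel q holomorphic_on (ball 0 1 - cball 0 (cmod q))"
proof -
  let ?A = "ball 0 1 - cball 0 (cmod q)"
  have im: "cmod (q / z) < 1" "z \<noteq> 0" if "z \<in> ?A" for z
  proof -
    have "cmod q < cmod z" using that by simp
    then show "cmod (q / z) < 1" "z \<noteq> 0" by (auto simp: norm_divide divide_less_eq)
  qed
  have h1: "f holomorphic_on ?A" "deriv f holomorphic_on ?A"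
    using hol hol' by (auto intro: holomorphic_on_subset)
  have "(reflect f \<circ> (\<lambda>z. q / z)) holomorphic_on ?A"
    using im by (intro holomorphic_on_compose_gen[OF _ reflect_hol] holomorphic_intros) auto
  then have h2: "(\<lambda>z. reflect f (q / z)) holomorphic_on ?A" by (simp add: o_def)
  show ?thesis unfolding kernel_def[abs_def]
    by (intro holomorphic_intros h1 h2) (use im kernel_denominator in auto)
qed

lemma mean_kernel_eq:
  assumes "cmod q < r" "r < 1"
  shows "mean_kernel q = circle_mean r (kernel q)"
  unfolding mean_kernel_def
  using assms by (intro circle_mean_radius_independent[OF kernel_hol, of q]) auto

definition kernel' :: "complex \<Rightarrow> complex \<Rightarrow> complex" where
  "kernel' q z = 2 * deriv f z * deriv (reflect f) (q / z) / (1 + reflect f (q / z) * f z)\<^sup>2"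

lemma kernel_deriv:
  assumes "cmod q < cmod z" "cmod z < 1"
  shows "((\<lambda>q. kernel q z) has_field_derivative kernel' q z) (at q)"
proof -
  define u where "u = (\<lambda>q. reflect f (q / z))"
  have z: "z \<noteq> 0" using assms by auto
  have qz: "cmod (q / z) < 1" using assms z by (simp add: norm_divide)
  have nz: "1 + u q * f z \<noteq> 0" using kernel_denominator[OF qz assms(2)] by (simp add: u_def)
  have "(reflect f has_field_derivative deriv (reflect f) (q / z)) (at (q / z))"
    using holomorphic_derivI[OF reflect_hol open_ball] qz by simp
  moreover have "((\<lambda>q. q / z) has_field_derivative 1 / z) (at q)"
    using z by (auto intro!: derivative_eq_intros)
  ultimately have u: "(u has_field_derivative deriv (reflect f) (q / z) * (1 / z)) (at q)"
    unfolding u_def by (rule DERIV_chain2)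
  define u' where "u' = deriv (reflect f) (q / z) * (1 / z)"
  have "((\<lambda>q. 2 * z * deriv f z * u q) has_field_derivative 2 * z * deriv f z * u') (at q)"
    "((\<lambda>q. 1 + u q * f z) has_field_derivative u' * f z) (at q)"
    using u by (auto intro!: derivative_eq_intros simp: u'_def)
  from DERIV_divide[OF this nz]
  have "((\<lambda>q. 2 * z * deriv f z * u q / (1 + u q * f z)) has_field_derivative
     2 * z * deriv f z * u' / (1 + u q * f z)\<^sup>2) (at q)"
    by (simp add: power2_eq_square algebra_simps)
  then show ?thesis using z by (simp add: kernel_def kernel'_def u_def u'_def mult.assoc)
qed

lemma circle_mean_kernel_deriv:
  assumes q: "cmod q < r" and r: "r < 1"
  shows "((\<lambda>q. circle_mean r (kernel q)) has_field_derivative circle_mean r (kernel' q)) (at q)"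
proof -
  have r0: "r > 0" using q by (metis norm_ge_zero order_le_less_trans)
  let ?z = "\<lambda>t. of_real r * cis t"
  have zr: "cmod (?z t) = r" for t using r0 by (simp add: norm_mult)
  have inb: "q / ?z t \<in> ball 0 1" if "q \<in> ball 0 r" for q t
    using that r0 by (simp add: norm_divide norm_mult)
  have cf: "continuous_on (ball 0 1) f" "continuous_on (ball 0 1) (deriv f)"
     "continuous_on (ball 0 1) (reflect f)" "continuous_on (ball 0 1) (deriv (reflect f))"
    using hol hol' reflect_hol holomorphic_deriv[OF reflect_hol open_ball]
    by (auto intro: holomorphic_on_imp_continuous_on)
  have "((\<lambda>q. integral (cbox 0 (2*pi)) (\<lambda>t. kernel q (?z t))) has_field_derivative
      integral (cbox 0 (2*pi)) (\<lambda>t. kernel' q (?z t))) (at q within ball 0 r)"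
  proof (rule leibniz_rule_field_derivative)
    fix x :: complex and t :: real assume "x \<in> ball 0 r" "t \<in> cbox 0 (2 * pi)"
    then show "((\<lambda>q. kernel q (?z t)) has_field_derivative kernel' x (?z t)) (at x within ball 0 r)"
      using kernel_deriv[of x "?z t"] zr r by (auto intro: has_field_derivative_at_within)
  next
    fix x :: complex assume x: "x \<in> ball 0 r"
    have "continuous_on {0..2*pi} (\<lambda>t. kernel x (?z t))"
      unfolding kernel_def
      by (intro continuous_intros continuous_on_compose2[OF cf(1)] continuous_on_compose2[OF cf(2)] continuous_on_compose2[OF cf(3)])
         (use inb[OF x] zr r r0 kernel_denominator in \<open>auto simp: norm_mult\<close>)
    then show "(\<lambda>t. kernel x (?z t)) integrable_on cbox 0 (2 * pi)"
      by (simp add: integrable_continuous_interval)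
  next
    show "continuous_on (ball 0 r \<times> cbox 0 (2 * pi)) (\<lambda>(x, t). kernel' x (?z t))"
      unfolding kernel'_def split_beta
      by (intro continuous_intros continuous_on_compose2[OF cf(1)] continuous_on_compose2[OF cf(2)]
             continuous_on_compose2[OF cf(3)] continuous_on_compose2[OF cf(4)])
         (use inb zr r r0 kernel_denominator in \<open>auto simp: norm_mult\<close>)
  qed (use q in auto)
  then have "((\<lambda>q. integral {0..2*pi} (\<lambda>t. kernel q (?z t))) has_field_derivative
      integral {0..2*pi} (\<lambda>t. kernel' q (?z t))) (at q)"
    using q by (simp add: at_within_open[of q "ball 0 r"])
  then show ?thesis unfolding circle_mean_def by (rule DERIV_cdivide)
qed

lemma mean_kernel_deriv:
  assumes q: "cmod q < r" and r: "r < 1"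
  shows "(mean_kernel has_field_derivative circle_mean r (kernel' q)) (at q)"
proof (rule has_field_derivative_transform_within_open[OF circle_mean_kernel_deriv[OF assms]])
  show "open (ball 0 r :: complex set)" "q \<in> ball 0 r" using q by auto
  fix x :: complex assume "x \<in> ball 0 r"
  then show "circle_mean r (kernel x) = mean_kernel x" using mean_kernel_eq[of x r] r by simp
qed

lemma mean_kernel_hol: "mean_kernel holomorphic_on ball 0 1"
proof -
  have "mean_kernel field_differentiable at q" if "cmod q < 1" for q
  proof -
    obtain r where "cmod q < r" "r < 1" using \<open>cmod q < 1\<close> dense by blast
    then show ?thesis using mean_kernel_deriv field_differentiable_def by blast
  qed
  then show ?thesis by (auto simp: holomorphic_on_def intro: field_differentiable_at_within)
qed

lemma mean_kernel_0: "mean_kernel 0 = 0"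
  by (simp add: mean_kernel_def circle_mean_def kernel_def reflect_def f0)

lemma deriv_reflect_0: "deriv (reflect f) 0 = cnj (deriv f 0)"
proof -
  have "(f has_field_derivative deriv f 0) (at (cnj 0))"
    using holomorphic_derivI[OF hol open_ball, of 0] by simp
  from has_field_derivative_cnj_cnj[OF this] show ?thesis
    by (intro DERIV_imp_deriv) (simp add: reflect_def[abs_def] o_def)
qed

lemma deriv_mean_kernel_0: "deriv mean_kernel 0 = of_real (2 * (cmod (deriv f 0))\<^sup>2)"
proof -
  have "deriv mean_kernel 0 = circle_mean (1/2) (kernel' 0)"
    by (intro DERIV_imp_deriv mean_kernel_deriv) auto
  also have "kernel' 0 = (\<lambda>z. 2 * deriv f z * cnj (deriv f 0))"
    by (simp add: kernel'_def fun_eq_iff deriv_reflect_0 reflect_def f0)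
  also have "circle_mean (1/2) \<dots> = 2 * deriv f 0 * cnj (deriv f 0)"
    by (intro circle_mean_holomorphic holomorphic_intros hol') auto
  also have "\<dots> = of_real (2 * (cmod (deriv f 0))\<^sup>2)" by (simp add: complex_norm_square del: of_real_power)
  finally show ?thesis .
qed

end

lemma circle_mean_Re:
  assumes "continuous_on {0..2*pi} (\<lambda>t. H (of_real r * cis t))"
  shows "Re (circle_mean r H) = integral {0..2*pi} (\<lambda>t. Re (H (of_real r * cis t))) / (2*pi)"
proof -
  have "Re (integral {0..2*pi} (\<lambda>t. H (of_real r * cis t))) = integral {0..2*pi} (\<lambda>t. Re (H (of_real r * cis t)))"
    using integral_linear[OF integrable_continuous_interval[OF assms] bounded_linear_Re] by (simp add: o_def)
  then show ?thesis unfolding circle_mean_def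
    by (metis Re_divide_of_real of_real_mult of_real_numeral)
qed

lemma circle_mean_Re_mono:
  assumes "continuous_on {0..2*pi} (\<lambda>t. F (of_real r * cis t))" "continuous_on {0..2*pi} (\<lambda>t. G (of_real r * cis t))"
    and "\<And>t. Re (F (of_real r * cis t)) \<le> Re (G (of_real r * cis t))"
  shows "Re (circle_mean r F) \<le> Re (circle_mean r G)"
  unfolding circle_mean_Re[OF assms(1)] circle_mean_Re[OF assms(2)]
  by (intro divide_right_mono integral_le integrable_continuous_interval continuous_intros assms) auto

lemma circle_mean_diff:
  assumes "continuous_on {0..2*pi} (\<lambda>t. F (of_real r * cis t))" "continuous_on {0..2*pi} (\<lambda>t. G (of_real r * cis t))"
  shows "circle_mean r (\<lambda>z. F z - G z) = circle_mean r F - circle_mean r G"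
  using assms by (simp add: circle_mean_def Henstock_Kurzweil_Integration.integral_diff integrable_continuous_interval diff_divide_distrib)

lemma continuous_on_circle:
  assumes "G holomorphic_on A" "\<And>t. of_real r * cis t \<in> A"
  shows "continuous_on {0..2*pi} (\<lambda>t. G (of_real r * cis t))"
  using assms by (intro continuous_on_compose2[OF holomorphic_on_imp_continuous_on[OF assms(1)]] continuous_intros) auto


locale spherically_convex_map = antipode_free +
  assumes inj: "inj_on f (ball 0 1)"
    and convex_charts: "\<And>\<zeta>. cmod \<zeta> < 1 \<Longrightarrow> convex ((\<lambda>z. (f z - f \<zeta>) / (1 + cnj (f \<zeta>) * f z)) ` ball 0 1)"
begin

lemma deriv_nonzero: "cmod z < 1 \<Longrightarrow> deriv f z \<noteq> 0"
  using holomorphic_injective_imp_regular[OF hol open_ball inj] by simp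

text \<open>With \<open>g\<close> the composition of \<open>f\<close> with the chart at \<open>w = f (e z)\<close>, the difference of the two sides is
  the real part of \<open>z g'(z) / (g z - g (e z))\<close>, where \<open>g (e z) = 0\<close>.\<close>
lemma two_point_inequality:
  assumes z: "cmod z < 1" "z \<noteq> 0" and e: "cmod e = 1" "e \<noteq> 1"
  shows "Re (z * deriv f z * cnj (f (e * z)) / (1 + cnj (f (e * z)) * f z))
       \<le> Re (z * deriv f z / (f z - f (e * z)))"
proof -
  define w where "w = f (e * z)"
  have ez: "cmod (e * z) < 1" "e * z \<noteq> z" using z e by (auto simp: norm_mult)
  define g where "g = (\<lambda>z. (f z - w) / (1 + cnj w * f z))"
  have nz: "1 + cnj w * f x \<noteq> 0" if "cmod x < 1" for x using antipode_free[OF that ez(1)] by (simp add: w_def)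
  have ghol: "g holomorphic_on ball 0 1" unfolding g_def using nz by (intro holomorphic_intros hol) auto
  have w1: "1 + cnj w * w \<noteq> 0" using nz[OF ez(1)] by (simp add: w_def)
  have ginj: "inj_on g (ball 0 1)"
  proof (rule inj_onI)
    fix x y assume xy: "x \<in> ball 0 1" "y \<in> ball 0 1" "g x = g y"
    then have "(f x - w) * (1 + cnj w * f y) = (f y - w) * (1 + cnj w * f x)"
      using nz[of x] nz[of y] by (simp add: g_def frac_eq_eq)
    then have "(f x - f y) * (1 + cnj w * w) = 0" by (simp add: algebra_simps)
    then have "f x = f y" using w1 by simp
    then show "x = y" using inj xy by (auto dest: inj_onD)
  qed
  have gconv: "convex (g ` ball 0 1)" using convex_charts[OF ez(1)] by (simp add: g_def w_def)
  have g0: "g (e * z) = 0" by (simp add: g_def w_def)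
  define d where "d = 1 + cnj w * f z"
  have d0: "d \<noteq> 0" using nz[OF z(1)] by (simp add: d_def)
  have fz: "f z - w \<noteq> 0" using ez z inj by (auto simp: w_def dest: inj_onD)
  have f': "(f has_field_derivative deriv f z) (at z)" using holomorphic_derivI[OF hol open_ball] z by simp
  have "((\<lambda>x. f x - w) has_field_derivative deriv f z) (at z)"
    "((\<lambda>x. 1 + cnj w * f x) has_field_derivative cnj w * deriv f z) (at z)"
    using f' by (auto intro!: derivative_eq_intros)
  from DERIV_divide[OF this nz[OF z(1)]]
  have "(g has_field_derivative deriv f z * (1 + cnj w * w) / d\<^sup>2) (at z)"
    by (simp add: g_def d_def power2_eq_square algebra_simps)
  then have dg: "deriv g z = deriv f z * (1 + cnj w * w) / d\<^sup>2" by (rule DERIV_imp_deriv)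
  define Y where "Y = cnj z * g z / deriv g z"
  have "Re (cnj z * (g (e * z) - g z) / deriv g z) \<le> 0"
    by (rule convex_map_two_points[OF ghol ginj gconv z(1) e(1)])
  then have "0 \<le> Re Y" by (simp add: g0 Y_def)
  have Ynz: "Y \<noteq> 0" using z fz d0 dg w1 deriv_nonzero[OF z(1)] by (simp add: Y_def g_def d_def)
  have "z * deriv f z / (f z - w) - z * deriv f z * cnj w / d = z * deriv f z * (1 + cnj w * w) / ((f z - w) * d)"
    using fz d0 by (simp add: divide_simps) (simp add: d_def algebra_simps)
  also have "\<dots> = z * cnj z / Y"
    unfolding Y_def dg using z fz d0 w1 deriv_nonzero[OF z(1)]
    by (simp add: g_def d_def[symmetric] power2_eq_square)
  also have "\<dots> = of_real ((cmod z)\<^sup>2 / (cmod Y)\<^sup>2) * cnj Y"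
    using Ynz by (simp add: complex_norm_square del: of_real_power)
  finally have "Re (z * deriv f z / (f z - w) - z * deriv f z * cnj w / d) = (cmod z)\<^sup>2 / (cmod Y)\<^sup>2 * Re Y"
    by (simp only: times_complex.sel Re_complex_of_real Im_complex_of_real) simp
  also have "\<dots> \<ge> 0" using \<open>0 \<le> Re Y\<close> by simp
  finally show ?thesis by (simp add: w_def d_def)
qed

text \<open>The integrand extends holomorphically over \<open>0\<close>, where its value \<open>1 / (1 - e)\<close> is the mean.\<close>
lemma circle_mean_difference_quotient:
  assumes e: "cmod e = 1" "e \<noteq> 1" and r: "0 < r" "r < 1"
  defines "L \<equiv> \<lambda>z. z * deriv f z / (f z - f (e * z))"
  shows "circle_mean r L = 1 / (1 - e)" "continuous_on {0..2*pi} (\<lambda>t. L (of_real r * cis t))"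
proof -
  define h where "h = (\<lambda>z. f z - f (e * z))"
  have fe: "(\<lambda>z. f (e * z)) holomorphic_on ball 0 1"
    using e by (intro holomorphic_on_compose_gen[OF _ hol, unfolded o_def]) (auto intro!: holomorphic_intros simp: norm_mult)
  have h: "h holomorphic_on ball 0 1" unfolding h_def by (intro holomorphic_intros hol fe)
  have h0: "h 0 = 0" by (simp add: h_def)
  have "(f has_field_derivative deriv f 0) (at 0)" using holomorphic_derivI[OF hol open_ball, of 0] by simp
  moreover have "(f has_field_derivative deriv f 0) (at (e * 0))" using calculation by simp
  then have "((\<lambda>z. f (e * z)) has_field_derivative deriv f 0 * e) (at 0)"
    by (rule DERIV_chain2) (auto intro!: derivative_eq_intros)
  ultimately have "(h has_field_derivative deriv f 0 - deriv f 0 * e) (at 0)"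
    unfolding h_def by (rule DERIV_diff)
  then have dh: "deriv h 0 = deriv f 0 * (1 - e)" by (simp add: DERIV_imp_deriv algebra_simps)
  define k where "k = (\<lambda>z. if z = 0 then deriv h 0 else (h z - h 0) / (z - 0))"
  have k: "k holomorphic_on ball 0 1" unfolding k_def by (rule pole_lemma_open[OF h open_ball])
  have k0: "k z \<noteq> 0" if "z \<in> ball 0 1" for z
  proof (cases "z = 0")
    case True
    then show ?thesis using e deriv_nonzero[of 0] by (simp add: k_def dh)
  next
    case False
    have "e * z \<noteq> z" "e * z \<in> ball 0 1" using False e that by (auto simp: norm_mult)
    then have "f z \<noteq> f (e * z)" using inj that by (metis inj_onD)
    then show ?thesis using False by (simp add: k_def h_def f0)
  qed
  define M where "M = (\<lambda>z. deriv f z / k z)"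
  have M: "M holomorphic_on ball 0 1" unfolding M_def using k0 by (intro holomorphic_intros hol' k) auto
  have LM: "L (of_real r * cis t) = M (of_real r * cis t)" for t
    using r h0 by (simp add: L_def M_def k_def h_def)
  have "circle_mean r L = circle_mean r M" unfolding circle_mean_def LM ..
  also have "\<dots> = M 0" by (rule circle_mean_holomorphic[OF M r])
  also have "\<dots> = 1 / (1 - e)" using deriv_nonzero[of 0] by (simp add: M_def k_def dh)
  finally show "circle_mean r L = 1 / (1 - e)" .
  show "continuous_on {0..2*pi} (\<lambda>t. L (of_real r * cis t))"
    unfolding LM using r by (intro continuous_on_circle[OF M]) (auto simp: norm_mult)
qed

lemma kernel_continuous_on_circle:
  assumes "cmod q < r" "r < 1"
  shows "continuous_on {0..2*pi} (\<lambda>t. kernel q (of_real r * cis t))"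
proof (rule continuous_on_circle[OF kernel_hol])
  have "r > 0" using assms by (metis norm_ge_zero order_le_less_trans)
  then show "of_real r * cis t \<in> ball 0 1 - cball 0 (cmod q)" for t using assms by (simp add: norm_mult)
qed (use assms in linarith)

text \<open>On the circle of radius \<open>sqrt \<bar>q\<bar>\<close> the point \<open>\<zeta>\<close> with \<open>cnj \<zeta> = q / z\<close> is \<open>e z\<close> with
  \<open>e = cnj q / \<bar>q\<bar>\<close>, so the mean of the two-point inequality applies if \<open>e \<noteq> 1\<close>; its right hand side
  is \<open>2 Re (1 / (1 - e)) = 1\<close>. For \<open>q > 0\<close> the bound follows by continuity.\<close>
lemma Re_mean_kernel_le_1:
  assumes q: "cmod q < 1"
  shows "Re (mean_kernel q) \<le> 1"
proof -
  have generic: "Re (mean_kernel q) \<le> 1" if q: "cmod q < 1" and q0: "q \<noteq> of_real (cmod q)" for q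
  proof -
    define r where "r = sqrt (cmod q)"
    define e where "e = cnj q / of_real (cmod q)"
    have qnz: "q \<noteq> 0" using q0 by auto
    have r: "0 < r" "r < 1" using q qnz by (auto simp: r_def)
    have r2: "r * r = cmod q" by (simp add: r_def)
    have "cmod q < r" using r r2 by (metis mult.right_neutral mult_strict_left_mono)
    have e: "cmod e = 1" using qnz by (simp add: e_def norm_divide)
    have "e \<noteq> 1"
    proof
      assume "e = 1"
      then have "cnj q = of_real (cmod q)" using qnz by (simp add: e_def)
      then have "q = of_real (cmod q)" by (metis complex_cnj_cnj complex_cnj_complex_of_real)
      then show False using q0 by simp
    qed
    have k: "kernel q z / 2 = z * deriv f z * cnj (f (e * z)) / (1 + cnj (f (e * z)) * f z)" if "cmod z = r" for z
    proof -
      have znz: "z \<noteq> 0" using that r by auto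
      have "z * cnj z = of_real (cmod q)" using that r2 by (simp add: complex_norm_square[symmetric] power2_eq_square flip: of_real_mult)
      then have "q / z = cnj (e * z)" using znz qnz by (simp add: e_def field_simps)
      then have "kernel q z = 2 * (z * deriv f z * cnj (f (e * z)) / (1 + cnj (f (e * z)) * f z))"
        by (simp add: kernel_def reflect_def)
      then show ?thesis by (metis nonzero_mult_div_cancel_left zero_neq_numeral)
    qed
    define L where "L = (\<lambda>z. z * deriv f z / (f z - f (e * z)))"
    have "Re (mean_kernel q) = Re (circle_mean r (kernel q))"
      using mean_kernel_eq[OF \<open>cmod q < r\<close> r(2)] by simp
    also have "\<dots> \<le> Re (circle_mean r (\<lambda>z. 2 * L z))"
    proof (rule circle_mean_Re_mono)
      show "continuous_on {0..2*pi} (\<lambda>t. kernel q (of_real r * cis t))"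
        by (rule kernel_continuous_on_circle) fact+
      show "continuous_on {0..2*pi} (\<lambda>t. 2 * L (of_real r * cis t))"
        unfolding L_def by (intro continuous_on_mult continuous_on_const circle_mean_difference_quotient(2) e \<open>e \<noteq> 1\<close> r)
      fix t
      have c: "cmod (of_real r * cis t) = r" using r by (simp add: norm_mult)
      have "Re (kernel q (of_real r * cis t) / 2) \<le> Re (L (of_real r * cis t))"
        unfolding k[OF c] L_def using two_point_inequality[of "of_real r * cis t" e] c r e \<open>e \<noteq> 1\<close> by simp
      then show "Re (kernel q (of_real r * cis t)) \<le> Re (2 * L (of_real r * cis t))" by simp
    qed
    also have "circle_mean r (\<lambda>z. 2 * L z) = 2 * circle_mean r L" by (simp add: circle_mean_def)
    also have "circle_mean r L = 1 / (1 - e)"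
      unfolding L_def by (rule circle_mean_difference_quotient(1)[OF e \<open>e \<noteq> 1\<close> r])
    also have "Re (2 * (1 / (1 - e))) = 1"
    proof -
      have "(Re e)\<^sup>2 + (Im e)\<^sup>2 = 1" using e by (metis cmod_power2 one_power2)
      then have "(1 - Re e)\<^sup>2 + (Im e)\<^sup>2 = 2 * (1 - Re e)" by (simp add: power2_eq_square algebra_simps)
      moreover have "Re e \<noteq> 1"
      proof
        assume "Re e = 1"
        then have "Im e = 0" using \<open>(Re e)\<^sup>2 + (Im e)\<^sup>2 = 1\<close> by simp
        then show False using \<open>Re e = 1\<close> \<open>e \<noteq> 1\<close> by (simp add: complex_eq_iff)
      qed
      ultimately show ?thesis by (simp add: Re_divide)
    qed
    finally show ?thesis .
  qed
  show ?thesis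
  proof (cases "q = of_real (cmod q)")
    case False
    then show ?thesis using generic q by blast
  next
    case True
    define s where "s = cmod q"
    have "isCont mean_kernel q"
      using mean_kernel_hol q by (metis holomorphic_on_imp_continuous_on continuous_on_eq_continuous_at open_ball mem_ball_0)
    then have c: "isCont mean_kernel (of_real s)" using True by (simp add: s_def)
    show ?thesis
    proof (cases "q = 0")
      case True then show ?thesis by (simp add: mean_kernel_0)
    next
      case q0: False
      have s: "0 < s" "s < 1" using q0 q by (auto simp: s_def)
      have "((\<lambda>t. of_real s * cis t) \<longlongrightarrow> of_real s * cis 0) (at_right 0)"
        by (intro tendsto_intros)
      then have "((\<lambda>t. of_real s * cis t) \<longlongrightarrow> of_real s) (at_right 0)" by simp
      then have "((\<lambda>t. mean_kernel (of_real s * cis t)) \<longlongrightarrow> mean_kernel (of_real s)) (at_right 0)"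
        by (rule isCont_tendsto_compose[OF c])
      then have lim: "((\<lambda>t. Re (mean_kernel (of_real s * cis t))) \<longlongrightarrow> Re (mean_kernel (of_real s))) (at_right 0)"
        by (rule tendsto_Re)
      have "eventually (\<lambda>t. t \<in> {0<..<pi}) (at_right (0::real))"
        by (intro eventually_at_right_real) auto
      then have "eventually (\<lambda>t. Re (mean_kernel (of_real s * cis t)) \<le> 1) (at_right 0)"
      proof eventually_elim
        case (elim t)
        have n: "cmod (of_real s * cis t) = s" using s by (simp add: norm_mult)
        have "Im (of_real s * cis t) > 0" using s elim by (simp add: sin_gt_zero)
        then have "of_real s * cis t \<noteq> of_real (cmod (of_real s * cis t))" unfolding n by (metis Im_complex_of_real less_irrefl)
        then show ?case using generic[of "of_real s * cis t"] n s by simp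
      qed
      then have "Re (mean_kernel (of_real s)) \<le> 1"
        using tendsto_upperbound[OF lim] by simp
      then show ?thesis using \<open>q = of_real (cmod q)\<close> by (simp add: s_def)
    qed
  qed
qed

end


section \<open>Total curvature of the image of a circle\<close>
lemma has_vector_derivative_on_circle:
  assumes "(G has_field_derivative G') (at (of_real r * cis t))"
  shows "((\<lambda>t. G (of_real r * cis t)) has_vector_derivative G' * (\<i> * (of_real r * cis t))) (at t)"
proof -
  have "((\<lambda>u. of_real r * exp (\<i> * u)) has_field_derivative \<i> * (of_real r * exp (\<i> * of_real t))) (at (of_real t))"
    by (auto intro!: derivative_eq_intros)
  moreover have "(G has_field_derivative G') (at (of_real r * exp (\<i> * of_real t)))"
    using assms by (simp add: cis_conv_exp)
  ultimately have "((\<lambda>u. G (of_real r * exp (\<i> * u))) has_field_derivative G' * (\<i> * (of_real r * exp (\<i> * of_real t)))) (at (of_real t))"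
    by (rule DERIV_chain2[rotated])
  from has_vector_derivative_real_field[OF this] show ?thesis by (simp add: cis_conv_exp)
qed

text \<open>The velocity of the image curve is \<open>\<i> z f'(z)\<close> and its acceleration is the velocity times
  \<open>\<i> (1 + z f''(z) / f'(z))\<close>. This gives the Euclidean part of the curvature.\<close>
lemma spherical_curvature_image_circle:
  fixes f :: "complex \<Rightarrow> complex" and r t :: real
  assumes hol: "f holomorphic_on ball 0 1" and nz: "\<And>z. cmod z < 1 \<Longrightarrow> deriv f z \<noteq> 0"
    and r: "0 < r" "r < 1"
  defines "\<gamma> \<equiv> \<lambda>t. f (of_real r * cis t)" and "z \<equiv> of_real r * cis t"
  shows "spherical_curvature \<gamma> t * spherical_density (\<gamma> t) * cmod (vector_derivative \<gamma> (at t))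
     = Re (1 + z * deriv (deriv f) z / deriv f z - 2 * z * deriv f z * cnj (f z) / (1 + cnj (f z) * f z))"
proof -
  have inb: "of_real r * cis s \<in> ball 0 1" for s using r by (simp add: norm_mult)
  have hol': "deriv f holomorphic_on ball 0 1" by (rule holomorphic_deriv[OF hol open_ball])
  have v: "vector_derivative \<gamma> (at s) = deriv f (of_real r * cis s) * (\<i> * (of_real r * cis s))" for s
    unfolding \<gamma>_def
    by (intro vector_derivative_at has_vector_derivative_on_circle holomorphic_derivI[OF hol open_ball] inb)
  define V where "V = (\<lambda>x. deriv f x * (\<i> * x))"
  have v': "vector_derivative \<gamma> (at s) = V (of_real r * cis s)" for s by (simp add: v V_def)
  have "(deriv f has_field_derivative deriv (deriv f) z) (at z)"
    using holomorphic_derivI[OF hol' open_ball inb, of t] by (simp add: z_def)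
  then have "(V has_field_derivative deriv (deriv f) z * (\<i> * z) + deriv f z * \<i>) (at z)"
    unfolding V_def by (auto intro!: derivative_eq_intros)
  then have a: "vector_derivative (\<lambda>s. vector_derivative \<gamma> (at s)) (at t)
      = (deriv (deriv f) z * (\<i> * z) + deriv f z * \<i>) * (\<i> * z)"
    unfolding v' z_def by (intro vector_derivative_at has_vector_derivative_on_circle)
  define d where "d = deriv f z"
  have d0: "d \<noteq> 0" using nz[of z] inb[of t] by (simp add: d_def z_def)
  have z0: "z \<noteq> 0" using r by (simp add: z_def)
  define v where "v = d * (\<i> * z)"
  have vt: "vector_derivative \<gamma> (at t) = v" by (simp add: v' V_def v_def d_def z_def)
  have v0: "v \<noteq> 0" using d0 z0 by (simp add: v_def)
  define c where "c = 1 + z * deriv (deriv f) z / d"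
  have "vector_derivative (\<lambda>s. vector_derivative \<gamma> (at s)) (at t) = v * (\<i> * c)"
    unfolding a v_def c_def d_def[symmetric] using d0 by (simp add: field_simps)
  moreover have "Im (cnj v * (v * (\<i> * c))) = (cmod v)\<^sup>2 * Re c"
  proof -
    have "cnj v * (v * (\<i> * c)) = of_real ((cmod v)\<^sup>2) * (\<i> * c)"
      by (simp add: complex_norm_square del: of_real_power)
    then show ?thesis by (simp only: times_complex.sel Re_complex_of_real Im_complex_of_real) simp
  qed
  ultimately have k: "euclidean_curvature \<gamma> t * cmod v = Re c"
    unfolding euclidean_curvature_def Let_def vt using v0 by (simp add: power2_eq_square power3_eq_cube)
  define N where "N = 1 + (cmod (f z))\<^sup>2"
  have N: "N > 0" by (simp add: N_def add_pos_nonneg)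
  have Nc: "1 + cnj (f z) * f z = of_real N"
    by (simp add: N_def complex_norm_square mult.commute del: of_real_power)
  have gt: "\<gamma> t = f z" by (simp add: \<gamma>_def z_def)
  have "2 * cnj (f z) * v = \<i> * (2 * z * d * cnj (f z))" by (simp add: v_def algebra_simps)
  then have "Im (2 * cnj (f z) * v) = Re (2 * z * d * cnj (f z))"
    by (simp only: Im_i_times)
  moreover have "Im (2 * cnj (f z) * v / of_real (N * cmod v)) * cmod v = Im (2 * cnj (f z) * v) / N"
    using v0 N by (simp add: Im_divide_of_real del: of_real_mult)
  ultimately have i: "Im (2 * cnj (f z) * v / of_real (N * cmod v)) * cmod v = Re (2 * z * d * cnj (f z) / of_real N)"
    by (simp only: Re_divide_of_real)
  have "spherical_curvature \<gamma> t * spherical_density (\<gamma> t) * cmod (vector_derivative \<gamma> (at t))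
      = (euclidean_curvature \<gamma> t - Im (2 * cnj (f z) * v / of_real (N * cmod v))) * cmod v"
    unfolding spherical_curvature_def Let_def vt gt spherical_density_def N_def[symmetric] using N by simp
  also have "\<dots> = Re c - Re (2 * z * d * cnj (f z) / of_real N)"
    unfolding left_diff_distrib k i ..
  finally show ?thesis unfolding Nc c_def d_def by simp
qed

context spherically_convex_map
begin

text \<open>The Euclidean part \<open>Re (1 + z f''(z) / f'(z))\<close> is harmonic with value \<open>1\<close> at \<open>0\<close>. In the other part
  \<open>cnj z = r\<^sup>2 / z\<close> on the circle, so that part is \<open>kernel (r\<^sup>2) z\<close>.\<close>
lemma total_curvature_image_circle:
  assumes r: "0 < r" "r < 1"
  shows "total_spherical_curvature 0 (2*pi) (\<lambda>t. f (of_real r * cis t)) = 2 * pi * (1 - Re (mean_kernel (of_real (r\<^sup>2))))"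
proof -
  define A where "A = (\<lambda>z. 1 + z * deriv (deriv f) z / deriv f z)"
  have A: "A holomorphic_on ball 0 1"
    unfolding A_def using deriv_nonzero
    by (intro holomorphic_intros hol' holomorphic_deriv[OF hol' open_ball]) auto
  have r2: "cmod (of_real (r\<^sup>2)) < r"
    unfolding norm_of_real using r by (simp add: power2_eq_square)
  have cA: "continuous_on {0..2*pi} (\<lambda>t. A (of_real r * cis t))"
    by (rule continuous_on_circle[OF A]) (use r in \<open>simp add: norm_mult\<close>)
  have ck: "continuous_on {0..2*pi} (\<lambda>t. kernel (of_real (r\<^sup>2)) (of_real r * cis t))"
    by (rule kernel_continuous_on_circle[OF r2 r(2)])
  have k: "kernel (of_real (r\<^sup>2)) z = 2 * z * deriv f z * cnj (f z) / (1 + cnj (f z) * f z)" if "cmod z = r" for z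
  proof -
    have z: "z \<noteq> 0" using that r by auto
    have "of_real (r\<^sup>2) = z * cnj z" using that by (simp add: complex_norm_square[symmetric])
    then have "of_real (r\<^sup>2) / z = cnj z" using z by simp
    then show ?thesis by (simp only: kernel_def reflect_def complex_cnj_cnj)
  qed
  have "total_spherical_curvature 0 (2*pi) (\<lambda>t. f (of_real r * cis t))
      = integral {0..2*pi} (\<lambda>t. Re (A (of_real r * cis t) - kernel (of_real (r\<^sup>2)) (of_real r * cis t)))"
    unfolding total_spherical_curvature_def
  proof (rule integral_cong)
    fix t :: real
    have c: "cmod (of_real r * cis t) = r" using r by (simp add: norm_mult)
    show "spherical_curvature (\<lambda>t. f (of_real r * cis t)) t * spherical_density (f (of_real r * cis t)) *
        cmod (vector_derivative (\<lambda>t. f (of_real r * cis t)) (at t))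
      = Re (A (of_real r * cis t) - kernel (of_real (r\<^sup>2)) (of_real r * cis t))"
      using spherical_curvature_image_circle[OF hol deriv_nonzero r, of t] unfolding k[OF c] A_def .
  qed
  also have "\<dots> = 2 * pi * Re (circle_mean r (\<lambda>z. A z - kernel (of_real (r\<^sup>2)) z))"
    by (subst circle_mean_Re) (use cA ck in \<open>auto intro!: continuous_on_diff\<close>)
  also have "circle_mean r (\<lambda>z. A z - kernel (of_real (r\<^sup>2)) z) = circle_mean r A - circle_mean r (kernel (of_real (r\<^sup>2)))"
    by (rule circle_mean_diff[OF cA ck])
  also have "circle_mean r A = 1"
    using circle_mean_holomorphic[OF A r] by (simp add: A_def)
  also have "circle_mean r (kernel (of_real (r\<^sup>2))) = mean_kernel (of_real (r\<^sup>2))"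
    using mean_kernel_eq[OF r2 r(2)] by simp
  finally show ?thesis by simp
qed

text \<open>The total curvature of the circle itself is \<open>2 \<pi> (1 - r\<^sup>2) / (1 + r\<^sup>2)\<close>, so its reciprocal supplies
  precisely the factor \<open>(1 + x) / (1 - x)\<close> of Harnack's inequality at \<open>x = r\<^sup>2\<close>.\<close>
lemma Phi_s_eq:
  assumes r: "0 < r" "r < 1"
  shows "Phi_s f r = Re (1 - mean_kernel (of_real (r\<^sup>2))) * (1 + r\<^sup>2) / (1 - r\<^sup>2)"
  unfolding Phi_s_def total_curvature_image_circle[OF r] total_spherical_curvature_circle[OF r(1)]
  by (simp del: of_real_power)

text \<open>Harnack monotonicity for \<open>P = 1 - mean_kernel\<close>. Equal values at two radii would give
  \<open>P'(0) = - 2\<close>, while \<open>P'(0) = - 2 \<bar>f'(0)\<bar>\<^sup>2\<close>.\<close>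
lemma Phi_s_strict_mono:
  assumes "cmod (deriv f 0) \<noteq> 1"
  shows "strict_mono_on {0<..<1} (Phi_s f)"
proof (rule strict_mono_onI)
  fix r s :: real assume rs: "r \<in> {0<..<1}" "s \<in> {0<..<1}" "r < s"
  define P where "P = (\<lambda>q. 1 - mean_kernel q)"
  have P: "P holomorphic_on ball 0 1" unfolding P_def by (intro holomorphic_intros mean_kernel_hol)
  have pos: "0 \<le> Re (P q)" if "cmod q < 1" for q using Re_mean_kernel_le_1[OF that] by (simp add: P_def)
  have P0: "P 0 = 1" by (simp add: P_def mean_kernel_0)
  have "deriv P 0 = - deriv mean_kernel 0"
  proof (rule DERIV_imp_deriv)
    show "(P has_field_derivative - deriv mean_kernel 0) (at 0)"
      unfolding P_def using holomorphic_derivI[OF mean_kernel_hol open_ball, of 0]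
      by (auto intro!: derivative_eq_intros)
  qed
  then have dP: "deriv P 0 = - of_real (2 * (cmod (deriv f 0))\<^sup>2)" by (simp only: deriv_mean_kernel_0)
  have sq: "0 \<le> r\<^sup>2" "r\<^sup>2 < s\<^sup>2" "s\<^sup>2 < 1" using rs by (auto simp: power_strict_mono abs_square_less_1)
  have "Phi_s f r \<le> Phi_s f s"
    using Harnack_mono[OF P pos, of "r\<^sup>2" "s\<^sup>2"] sq rs Phi_s_eq[of r] Phi_s_eq[of s] by (simp add: P_def del: of_real_power)
  moreover have "Phi_s f r \<noteq> Phi_s f s"
  proof
    assume "Phi_s f r = Phi_s f s"
    then have "deriv P 0 = -2"
      using sq rs Phi_s_eq[of r] Phi_s_eq[of s]
      by (intro Harnack_equality[OF P pos P0, of "r\<^sup>2" "s\<^sup>2"]) (auto simp: P_def simp del: of_real_power)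
    then have "of_real (2 * (cmod (deriv f 0))\<^sup>2) = (of_real 2 :: complex)" unfolding dP by simp
    then have "2 * (cmod (deriv f 0))\<^sup>2 = 2" by (simp only: of_real_eq_iff)
    then have "cmod (deriv f 0) = 1" by (simp add: power2_eq_1_iff) (smt (verit) norm_ge_zero)
    then show False using assms by simp
  qed
  ultimately show "Phi_s f r < Phi_s f s" by simp
qed

lemma Phi_s_rotation:
  assumes "\<And>z. cmod z < 1 \<Longrightarrow> f z = b * z" "cmod b = 1" and r: "0 < r" "r < 1"
  shows "Phi_s f r = 1"
proof -
  have d: "deriv f z = b" if "cmod z < 1" for z
  proof (rule DERIV_imp_deriv, rule has_field_derivative_transform_within_open)
    show "((\<lambda>z. b * z) has_field_derivative b) (at z)" by (auto intro!: derivative_eq_intros)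
    show "open (ball 0 1 :: complex set)" "z \<in> ball 0 1" using that by auto
  qed (use assms(1) in auto)
  have r2: "cmod (of_real (r\<^sup>2)) < r"
    unfolding norm_of_real using r by (simp add: power2_eq_square)
  have bb: "cnj b * b = 1" using assms(2) by (metis complex_norm_square mult.commute of_real_1 one_power2)
  have "kernel (of_real (r\<^sup>2)) z = of_real (2 * r\<^sup>2 / (1 + r\<^sup>2))" if "cmod z = r" for z
  proof -
    have z: "z \<noteq> 0" using that r by auto
    have rz: "of_real (r\<^sup>2) = z * cnj z" using that by (simp add: complex_norm_square[symmetric])
    then have "of_real (r\<^sup>2) / z = cnj z" using z by simp
    then have "kernel (of_real (r\<^sup>2)) z = 2 * z * b * (cnj b * cnj z) / (1 + (cnj b * cnj z) * (b * z))"
      using that r by (simp add: kernel_def reflect_def d assms(1) del: of_real_power)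
    also have "2 * z * b * (cnj b * cnj z) = 2 * (cnj b * b) * (z * cnj z)" by (simp add: algebra_simps)
    also have "(cnj b * cnj z) * (b * z) = (cnj b * b) * (z * cnj z)" by (simp add: algebra_simps)
    finally show ?thesis unfolding bb rz[symmetric] by simp
  qed
  then have k: "kernel (of_real (r\<^sup>2)) (of_real r * cis t) = of_real (2 * r\<^sup>2 / (1 + r\<^sup>2))" for t
    using r by (simp add: norm_mult)
  have "mean_kernel (of_real (r\<^sup>2)) = circle_mean r (kernel (of_real (r\<^sup>2)))" by (rule mean_kernel_eq[OF r2 r(2)])
  also have "\<dots> = circle_mean r (\<lambda>z. of_real (2 * r\<^sup>2 / (1 + r\<^sup>2)))" unfolding circle_mean_def k ..
  also have "\<dots> = of_real (2 * r\<^sup>2 / (1 + r\<^sup>2))" by (rule circle_mean_holomorphic) (use r in auto)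
  finally have "Re (mean_kernel (of_real (r\<^sup>2))) = 2 * r\<^sup>2 / (1 + r\<^sup>2)" by (simp only: Re_complex_of_real)
  then have "Phi_s f r = (1 - 2 * r\<^sup>2 / (1 + r\<^sup>2)) * (1 + r\<^sup>2) / (1 - r\<^sup>2)"
    unfolding Phi_s_eq[OF r] by simp
  also have "1 + r\<^sup>2 > 0" by (simp add: add_pos_nonneg)
  then have "(1 - 2 * r\<^sup>2 / (1 + r\<^sup>2)) * (1 + r\<^sup>2) = 1 - r\<^sup>2" by (simp add: left_diff_distrib)
  also have "r\<^sup>2 < 1" using r by (simp add: abs_square_less_1)
  then have "(1 - r\<^sup>2) / (1 - r\<^sup>2) = 1" by simp
  finally show ?thesis .
qed

end

section \<open>Maps into a hemisphere\<close>

text \<open>Let \<open>c\<close> be the centre of the hemisphere that \<open>a\<close> determines. The rotation taking \<open>c\<close> to \<open>0\<close> turns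
  \<open>f\<close> into \<open>g = (f - c) / (1 + cnj c f)\<close>, which is bounded by \<open>1\<close>, so \<open>\<bar>g'(0)\<bar> \<le> 1\<close>. But
  \<open>\<bar>g'(0)\<bar> = 1 + \<bar>c\<bar>\<^sup>2\<close>. Hence \<open>c = 0\<close>, and Schwarz's lemma applies to \<open>f\<close>.\<close>
lemma hemisphere_map_unit_derivative:
  fixes f :: "complex \<Rightarrow> complex" and a :: "complex \<times> real"
  assumes hol: "f holomorphic_on ball 0 1" and inj: "inj_on f (ball 0 1)" and f0: "f 0 = 0" and d1: "cmod (deriv f 0) = 1"
    and a: "a \<noteq> 0" "\<And>z. cmod z < 1 \<Longrightarrow> 0 \<le> a \<bullet> stereographic (Some (f z))"
  obtains b where "cmod b = 1" "\<And>z. cmod z < 1 \<Longrightarrow> f z = b * z"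
proof -
  obtain n k' where nk: "a = (n, k')" by (cases a)
  define k where "k = - k'"
  have "a \<bullet> stereographic (Some 0) = k" by (simp add: stereographic_def nk k_def)
  then have k: "k \<ge> 0" using a(2)[of 0] f0 by simp
  define N where "N = norm a"
  have N: "N > 0" using a(1) by (simp add: N_def)
  have N2: "N\<^sup>2 = (cmod n)\<^sup>2 + k\<^sup>2" by (simp add: N_def nk norm_Pair k_def)
  have hs: "0 \<le> k * (1 - (cmod w)\<^sup>2) + 2 * Re (w * cnj n)" if "0 \<le> a \<bullet> stereographic (Some w)" for w
  proof -
    have p: "1 + (cmod w)\<^sup>2 > 0" by (rule one_plus_cmod_sq_pos)
    have "n \<bullet> (2 * w / of_real (1 + (cmod w)\<^sup>2)) = n \<bullet> ((2 / (1 + (cmod w)\<^sup>2)) *\<^sub>R w)"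
      by (simp add: scaleR_conv_of_real)
    also have "\<dots> = 2 * Re (w * cnj n) / (1 + (cmod w)\<^sup>2)"
      by (simp add: inner_complex_def algebra_simps add_divide_distrib)
    finally have "a \<bullet> stereographic (Some w) = (2 * Re (w * cnj n) + k' * ((cmod w)\<^sup>2 - 1)) / (1 + (cmod w)\<^sup>2)"
      by (simp add: nk stereographic_def add_divide_distrib add.commute)
    then show ?thesis using that p by (simp add: k_def zero_le_divide_iff algebra_simps)
  qed
  \<comment> \<open>The hemisphere is \<open>k (1 - \<bar>w\<bar>\<^sup>2) + 2 Re (w cnj n) \<ge> 0\<close>; its centre is the stereographic
    preimage of the unit vector \<open>(n, - k) / N\<close>.\<close>
  define c where "c = n / of_real (N + k)"
  have Nk: "N + k > 0" using N k by simp
  have cc: "1 - (cmod c)\<^sup>2 = 2 * k / (N + k)"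
  proof -
    have "(cmod c)\<^sup>2 = (N\<^sup>2 - k\<^sup>2) / (N + k)\<^sup>2"
      using Nk unfolding N2 c_def norm_divide norm_of_real power_divide by simp
    also have "N\<^sup>2 - k\<^sup>2 = (N - k) * (N + k)" by (simp add: algebra_simps power2_eq_square)
    also have "(N - k) * (N + k) / (N + k)\<^sup>2 = (N - k) / (N + k)" using Nk by (simp add: power2_eq_square)
    finally show ?thesis using Nk by (simp add: field_simps)
  qed
  have key: "cmod (f z - c) \<le> cmod (1 + cnj c * f z)" if "cmod z < 1" for z
  proof -
    have "(cmod (1 + cnj c * f z))\<^sup>2 - (cmod (f z - c))\<^sup>2 = (1 - (cmod c)\<^sup>2) * (1 - (cmod (f z))\<^sup>2) + 4 * Re (f z * cnj c)"
      unfolding cmod_power2 by (simp add: power2_eq_square algebra_simps)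
    also have "Re (f z * cnj c) = Re (f z * cnj n) / (N + k)"
    proof -
      have "f z * cnj c = f z * cnj n / of_real (N + k)" by (simp add: c_def)
      then show ?thesis by (simp only: Re_divide_of_real)
    qed
    also have "(1 - (cmod c)\<^sup>2) * (1 - (cmod (f z))\<^sup>2) + 4 * (Re (f z * cnj n) / (N + k))
        = 2 * (k * (1 - (cmod (f z))\<^sup>2) + 2 * Re (f z * cnj n)) / (N + k)"
      unfolding cc distrib_left add_divide_distrib by simp
    also have "\<dots> \<ge> 0" using hs[OF a(2)[OF that]] Nk by (intro divide_nonneg_pos) auto
    finally have "(cmod (f z - c))\<^sup>2 \<le> (cmod (1 + cnj c * f z))\<^sup>2" by simp
    then show ?thesis by (rule power2_le_imp_le) simp
  qed
  have nz: "1 + cnj c * f z \<noteq> 0" if "cmod z < 1" for z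
  proof
    assume 0: "1 + cnj c * f z = 0"
    then have "f z = c" using key[OF that] by simp
    then have "of_real (1 + (cmod c)\<^sup>2) = (0::complex)" using 0 by (simp add: complex_norm_square mult.commute del: of_real_power)
    then show False using one_plus_cmod_sq_pos[of c] by (metis less_irrefl of_real_eq_0_iff)
  qed
  define g where "g = (\<lambda>z. (f z - c) / (1 + cnj c * f z))"
  have g: "g holomorphic_on ball 0 1" unfolding g_def using nz by (intro holomorphic_intros hol) auto
  have g1: "cmod (g z) \<le> 1" if "cmod z < 1" for z
    using key[OF that] nz[OF that] by (simp add: g_def norm_divide divide_le_eq)
  have df: "(f has_field_derivative deriv f 0) (at 0)" using holomorphic_derivI[OF hol open_ball, of 0] by simp
  have "((\<lambda>x. f x - c) has_field_derivative deriv f 0) (at 0)"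
    "((\<lambda>x. 1 + cnj c * f x) has_field_derivative cnj c * deriv f 0) (at 0)"
    using df by (auto intro!: derivative_eq_intros)
  from DERIV_divide[OF this]
  have "(g has_field_derivative deriv f 0 * (1 + cnj c * c)) (at 0)"
    by (simp add: g_def f0 algebra_simps)
  then have dg: "deriv g 0 = deriv f 0 * (1 + cnj c * c)" by (rule DERIV_imp_deriv)
  have "1 + cnj c * c = of_real (1 + (cmod c)\<^sup>2)" by (simp add: complex_norm_square mult.commute del: of_real_power)
  then have ndg: "cmod (deriv g 0) = 1 + (cmod c)\<^sup>2"
    unfolding dg norm_mult d1 using one_plus_cmod_sq_pos[of c] by (simp del: of_real_add)
  have "cmod (deriv g 0) * r \<le> 1" if r: "0 < r" "r < 1" for r
  proof -
    have "cmod ((deriv ^^ 1) g 0) \<le> fact 1 * 1 / r ^ 1"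
    proof (rule Cauchy_inequality)
      show "g holomorphic_on ball 0 r" using g r by (auto intro: holomorphic_on_subset)
      show "continuous_on (cball 0 r) g"
        using r by (intro continuous_on_subset[OF holomorphic_on_imp_continuous_on[OF g]]) auto
    qed (use r g1 in auto)
    then show ?thesis using r by (simp add: field_simps)
  qed
  then have "(1 + (cmod c)\<^sup>2) \<le> 1"
    unfolding ndg by (metis field_le_mult_one_interval mult.commute)
  then have "c = 0" by simp
  then have f1: "cmod (f z) \<le> 1" if "cmod z < 1" for z using g1[OF that] by (simp add: g_def)
  have "open (f ` ball 0 1)" by (rule open_mapping_thm3[OF hol open_ball inj])
  moreover have "f ` ball 0 1 \<subseteq> cball 0 1" using f1 by auto
  ultimately have "f ` ball 0 1 \<subseteq> ball 0 1" using interior_maximal interior_cball by metis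
  then have "cmod (f z) < 1" if "cmod z < 1" for z using that by (force simp: image_subset_iff)
  then obtain b where "\<forall>z. cmod z < 1 \<longrightarrow> f z = b * z" "cmod b = 1"
    using Schwarz_Lemma(3)[OF hol f0, of 0] d1 by auto
  then show thesis using that by blast
qed


section \<open>Images of spherically convex functions\<close>

text \<open>If \<open>f\<close> had a pole, then \<open>f(\<D>)\<close> would contain \<open>0\<close>, a neighbourhood of it, and infinity, hence every
  point of the plane; the inverse of \<open>f\<close> would be a bounded entire function, contradicting Liouville's
  theorem. An antipodal pair in \<open>f(\<D>)\<close> would bring infinity back, so there is none. The charts of
  \<open>f(\<D>)\<close> at its own points are therefore finite, and they are convex by \<open>convex_chart\<close>.\<close>
lemma normalized_spherically_convex_map:
  assumes "spherically_convex f" "centrally_normalized f"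
  shows "spherically_convex_map f"
    "\<And>p q. p \<in> sphere_map f ` unit_disc \<Longrightarrow> q \<in> sphere_map f ` unit_disc \<Longrightarrow> \<not> antipodal p q"
    "\<And>z. cmod z < 1 \<Longrightarrow> sphere_map f z = Some (f z)"
proof -
  define \<Omega> where "\<Omega> = sphere_map f ` unit_disc"
  have mero: "f nicely_meromorphic_on unit_disc" and sinj: "inj_on (sphere_map f) unit_disc"
    using assms(1) by (auto simp: spherically_convex_def)
  have geo: "geodesically_closed \<Omega>"
    using assms(1) unfolding spherically_convex_def spherically_convex_domain_def \<Omega>_def geodesically_closed_def by blast
  obtain F where F: "f has_fps_expansion F" "fps_nth F 0 = 0"
    using assms(2) by (auto simp: centrally_normalized_def)
  have f0: "f 0 = 0" using fps_nth_fps_expansion[OF F(1), of 0] F(2) by simp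
  have an: "f analytic_on {z}" if "cmod z < 1" "\<not> is_pole f z" for z
    using nicely_meromorphic_on_imp_analytic_at[OF mero] that by simp
  have local_image: "\<exists>\<epsilon>>0. Some ` ball (f z) \<epsilon> \<subseteq> \<Omega>" if z: "cmod z < 1" "f analytic_on {z}" for z
  proof -
    obtain \<delta> where \<delta>: "\<delta> > 0" "f holomorphic_on ball z \<delta>" using z(2) by (auto simp: analytic_on_def)
    define U where "U = ball z \<delta> \<inter> ball 0 1"
    have U: "open U" "z \<in> U" using z \<delta> by (auto simp: U_def)
    have hU: "f holomorphic_on U" using \<delta>(2) by (auto simp: U_def intro: holomorphic_on_subset)
    have np: "sphere_map f x = Some (f x)" if "x \<in> U" for x
    proof -
      have "f analytic_on {x}" using hU U(1) that analytic_at by blast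
      then have "\<not> is_pole f x" using analytic_at_imp_no_pole by blast
      then show ?thesis by (simp add: sphere_map_def)
    qed
    have "inj_on f U"
    proof (rule inj_onI)
      fix x y assume xy: "x \<in> U" "y \<in> U" "f x = f y"
      then have "sphere_map f x = sphere_map f y" by (simp add: np)
      then show "x = y" using xy inj_onD[OF sinj] by (auto simp: U_def)
    qed
    then have "open (f ` U)" using open_mapping_thm3[OF hU U(1)] by blast
    then obtain \<epsilon> where \<epsilon>: "\<epsilon> > 0" "ball (f z) \<epsilon> \<subseteq> f ` U" using U(2) by (meson image_eqI open_contains_ball)
    moreover have "Some ` f ` U \<subseteq> \<Omega>"
    proof
      fix p assume "p \<in> Some ` f ` U"
      then obtain x where "x \<in> U" "p = sphere_map f x" using np by auto
      then show "p \<in> \<Omega>" by (auto simp: \<Omega>_def U_def)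
    qed
    ultimately show ?thesis by (meson image_mono order_trans)
  qed
  have an0: "f analytic_on {0}" using has_fps_expansion_imp_analytic_0[OF F(1)] .
  have no_pole: "\<not> is_pole f p" if p: "cmod p < 1" for p
  proof
    assume pole: "is_pole f p"
    then have "None \<in> \<Omega>" using p by (auto simp: \<Omega>_def sphere_map_def image_iff intro!: bexI[of _ p])
    moreover obtain \<epsilon> where "\<epsilon> > 0" "Some ` ball 0 \<epsilon> \<subseteq> \<Omega>" using local_image[of 0] an0 f0 by auto
    ultimately have all: "Some c \<in> \<Omega>" for c by (intro geodesically_closed_0_infinity[of \<Omega> \<epsilon> c] geo)
    define D where "D = ball 0 1 - {p}"
    have np: "\<not> is_pole f z" if "z \<in> D" for z
    proof
      assume "is_pole f z"
      then have "sphere_map f z = sphere_map f p" using pole by (simp add: sphere_map_def)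
      then show False using that p inj_onD[OF sinj] by (auto simp: D_def)
    qed
    have oD: "open D" by (simp add: D_def open_Diff)
    have hD: "f holomorphic_on D"
      using an np by (intro analytic_imp_holomorphic) (auto simp: D_def analytic_on_def)
    have iD: "inj_on f D"
    proof (rule inj_onI)
      fix x y assume xy: "x \<in> D" "y \<in> D" "f x = f y"
      then have "sphere_map f x = sphere_map f y" using np by (simp add: sphere_map_def)
      then show "x = y" using xy inj_onD[OF sinj] by (auto simp: D_def)
    qed
    have "f ` D = UNIV"
    proof -
      have "c \<in> f ` D" for c
      proof -
        obtain z where z: "z \<in> ball 0 1" "sphere_map f z = Some c" using all[of c] by (auto simp: \<Omega>_def)
        then have "z \<noteq> p" using pole by (auto simp: sphere_map_def)
        moreover have "f z = c" using z by (auto simp: sphere_map_def split: if_splits)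
        ultimately show ?thesis using z by (auto simp: D_def)
      qed
      then show ?thesis by auto
    qed
    obtain h where h: "h holomorphic_on (f ` D)" "\<And>z. z \<in> D \<Longrightarrow> h (f z) = z"
      using holomorphic_has_inverse[OF hD oD iD] by metis
    have "bounded (range h)"
    proof -
      have "h y \<in> ball 0 1" for y
      proof -
        obtain z where "z \<in> D" "y = f z" using \<open>f ` D = UNIV\<close> by auto
        then show ?thesis using h(2) by (auto simp: D_def)
      qed
      then show ?thesis by (intro bounded_subset[OF bounded_ball[of 0 1]]) auto
    qed
    then have "h constant_on UNIV" using h(1) \<open>f ` D = UNIV\<close> by (intro Liouville_theorem) auto
    then obtain c where c: "\<And>y. h y = c" by (auto simp: constant_on_def)
    have "z = c" if "z \<in> D" for z using h(2)[OF that] c by simp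
    then have "finite D" by (intro finite_subset[of D "{c}"]) auto
    moreover have "0 \<in> D" using pole analytic_at_imp_no_pole[OF an0] by (auto simp: D_def)
    ultimately show False using oD finite_imp_not_open by blast
  qed
  show sm: "sphere_map f z = Some (f z)" if "cmod z < 1" for z
    using no_pole[OF that] by (simp add: sphere_map_def)
  have \<Omega>: "\<Omega> = Some ` f ` ball 0 1" using sm by (force simp: \<Omega>_def image_iff)
  have noinf: "None \<notin> \<Omega>" by (auto simp: \<Omega>)
  have hol: "f holomorphic_on ball 0 1"
    using an no_pole by (intro analytic_imp_holomorphic) (auto simp: analytic_on_def)
  have inj: "inj_on f (ball 0 1)"
  proof (rule inj_onI)
    fix x y assume "x \<in> ball 0 1" "y \<in> ball 0 1" "f x = f y"
    then show "x = y" using sm inj_onD[OF sinj, of x y] by simp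
  qed
  have anti: "\<not> antipodal p q" if pq: "p \<in> \<Omega>" "q \<in> \<Omega>" for p q
  proof
    assume "antipodal p q"
    obtain z \<zeta> where z: "cmod z < 1" "p = Some (f z)" and \<zeta>: "cmod \<zeta> < 1" "q = Some (f \<zeta>)"
      using pq unfolding \<Omega> by auto
    obtain \<epsilon> where "\<epsilon> > 0" "Some ` ball (f z) \<epsilon> \<subseteq> \<Omega>" using local_image[OF z(1) an[OF z(1) no_pole[OF z(1)]]] by blast
    then have "None \<in> \<Omega>"
      using geodesically_closed_antipodal[of \<Omega> \<epsilon> "f z" "f \<zeta>"] geo \<open>antipodal p q\<close> pq z \<zeta> by blast
    then show False using noinf by simp
  qed
  then show "\<And>p q. p \<in> sphere_map f ` unit_disc \<Longrightarrow> q \<in> sphere_map f ` unit_disc \<Longrightarrow> \<not> antipodal p q"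
    by (simp add: \<Omega>_def)
  have af: "1 + cnj (f \<zeta>) * f z \<noteq> 0" if "cmod z < 1" "cmod \<zeta> < 1" for z \<zeta>
  proof
    assume 0: "1 + cnj (f \<zeta>) * f z = 0"
    then have nz: "f \<zeta> \<noteq> 0" by auto
    have "f z = - 1 / cnj (f \<zeta>)" using 0 nz by (simp add: field_simps add_eq_0_iff)
    then have "antipodal (Some (f \<zeta>)) (Some (f z))" using antipodal_Some[OF nz] by simp
    then show False using anti that by (auto simp: \<Omega>)
  qed
  show "spherically_convex_map f"
  proof
    fix \<zeta> :: complex assume z: "cmod \<zeta> < 1"
    define w where "w = f \<zeta>"
    have "convex {p. moebius_sphere 1 w (- cnj w) 1 (Some p) \<in> \<Omega>}"
      using z by (intro convex_chart geo) (auto simp: w_def \<Omega>)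
    also have "{p. moebius_sphere 1 w (- cnj w) 1 (Some p) \<in> \<Omega>} = (\<lambda>z. (f z - w) / (1 + cnj w * f z)) ` ball 0 1"
      (is "?L = ?R")
    proof
      show "?L \<subseteq> ?R"
      proof
        fix p assume "p \<in> ?L"
        then obtain x where x: "cmod x < 1" "moebius_sphere 1 w (- cnj w) 1 (Some p) = Some (f x)" by (auto simp: \<Omega>)
        then have d: "1 - cnj w * p \<noteq> 0" and "(p + w) / (1 - cnj w * p) = f x"
          by (auto simp: moebius_sphere_def split: if_splits)
        then have "p + w = f x * (1 - cnj w * p)" by (simp add: field_simps)
        then have "p * (1 + cnj w * f x) = f x - w" by (simp add: algebra_simps)
        then have "p = (f x - w) / (1 + cnj w * f x)" using af[OF x(1) z] by (simp add: w_def field_simps)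
        then show "p \<in> ?R" using x by auto
      qed
      show "?R \<subseteq> ?L"
      proof
        fix p assume "p \<in> ?R"
        then obtain x where x: "cmod x < 1" "p = (f x - w) / (1 + cnj w * f x)" by auto
        define d where "d = 1 + cnj w * f x"
        have d: "d \<noteq> 0" "1 + cnj w * w \<noteq> 0" using af[OF x(1) z] af[OF z z] by (auto simp: w_def d_def)
        have p: "p = (f x - w) / d" using x by (simp add: d_def)
        have "1 - cnj w * p = (d - cnj w * (f x - w)) / d" by (subst diff_divide_distrib) (simp add: p d)
        also have "d - cnj w * (f x - w) = 1 + cnj w * w" by (simp add: d_def algebra_simps)
        finally have 1: "1 - cnj w * p = (1 + cnj w * w) / d" .
        have "p + w = (f x - w + w * d) / d" unfolding p using d by (simp add: add_divide_distrib)
        also have "f x - w + w * d = f x * (1 + cnj w * w)" by (simp add: d_def algebra_simps)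
        finally have 2: "p + w = f x * (1 + cnj w * w) / d" .
        have "moebius_sphere 1 w (- cnj w) 1 (Some p) = Some ((p + w) / (1 - cnj w * p))"
          using 1 d by (simp add: moebius_sphere_def)
        also have "(p + w) / (1 - cnj w * p) = f x" unfolding 1 2 using d by simp
        finally show "p \<in> ?L" using x by (auto simp: \<Omega>)
      qed
    qed
    finally show "convex ((\<lambda>z. (f z - f \<zeta>) / (1 + cnj (f \<zeta>) * f z)) ` ball 0 1)" by (simp add: w_def)
  qed (use hol f0 af inj in auto)
qed

lemma rotation_is_spherical_isometry:
  assumes "cmod b = 1" "\<And>z. cmod z < 1 \<Longrightarrow> sphere_map f z = Some (b * z)"
  shows "spherical_isometry f"
proof -
  define T where "T = moebius_sphere (cis (Arg b)) (- cis (Arg b) * 0) (cnj 0) 1"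
  have b: "cis (Arg b) = b" using assms(1) by (metis cis_Arg sgn_eq div_by_1 norm_eq_zero of_real_1 zero_neq_one)
  have "T \<in> Rot" unfolding Rot_def T_def by blast
  moreover have "sphere_map f z = T (Some z)" if "z \<in> unit_disc" for z
    using assms(2)[of z] that b by (simp add: T_def moebius_sphere_def)
  ultimately show ?thesis by (auto simp: spherical_isometry_def)
qed

theorem theorem1p6:
  fixes f :: "complex \<Rightarrow> complex"
  assumes "spherically_convex f" and "centrally_normalized f"
  shows "(\<not> spherical_isometry f \<longrightarrow> strict_mono_on {0<..<1} (Phi_s f)) \<and>
         (spherical_isometry f \<longrightarrow> (\<forall>r\<in>{0<..<1}. Phi_s f r = 1))"
proof -
  interpret spherically_convex_map f by (rule normalized_spherically_convex_map[OF assms])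
  note anti = normalized_spherically_convex_map(2)[OF assms]
  note sm = normalized_spherically_convex_map(3)[OF assms]
  have "spherical_isometry f" if d1: "cmod (deriv f 0) = 1"
  proof -
    have geo: "geodesically_closed (sphere_map f ` unit_disc)"
      using assms(1) unfolding spherically_convex_def spherically_convex_domain_def geodesically_closed_def by blast
    obtain a where a: "a \<noteq> 0" "\<And>p. p \<in> sphere_map f ` unit_disc \<Longrightarrow> 0 \<le> a \<bullet> stereographic p"
      using geodesically_closed_in_hemisphere[OF geo anti] by metis
    have "0 \<le> a \<bullet> stereographic (Some (f z))" if "cmod z < 1" for z
    proof -
      have "Some (f z) \<in> sphere_map f ` unit_disc" using sm[OF that] that by (metis imageI mem_ball_0)
      then show ?thesis by (rule a(2))
    qed
    then obtain b where "cmod b = 1" "\<And>z. cmod z < 1 \<Longrightarrow> f z = b * z"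
      using hemisphere_map_unit_derivative[OF hol inj f0 d1 a(1)] by metis
    then show ?thesis using sm by (intro rotation_is_spherical_isometry[of b]) auto
  qed
  moreover have "Phi_s f r = 1" if iso: "spherical_isometry f" and r: "r \<in> {0<..<1}" for r
  proof -
    obtain T where T: "T \<in> Rot" "\<And>z. cmod z < 1 \<Longrightarrow> Some (f z) = T (Some z)"
      using iso sm by (auto simp: spherical_isometry_def)
    have T0: "T (Some 0) = Some 0" using T(2)[of 0] f0 by simp
    have "\<exists>\<theta>. T = moebius_sphere (cis \<theta>) 0 0 1"
      using T(1) T0 unfolding Rot_def by (auto simp: moebius_sphere_def split: if_splits)
    then obtain \<theta> where \<theta>: "T = moebius_sphere (cis \<theta>) 0 0 1" by blast
    have "f z = cis \<theta> * z" if "cmod z < 1" for z using T(2)[OF that] by (simp add: \<theta> moebius_sphere_def)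
    then show ?thesis using r by (intro Phi_s_rotation[of "cis \<theta>"]) auto
  qed
  ultimately show ?thesis using Phi_s_strict_mono by blast
qed

end
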